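(* Let $n\ge2$ be an integer. The total number of spanning trees of $P_n$ is $$\tau(P_n)=\frac{\prod_{i=2}^{3n}\lambda_i\prod_{j=1}^{2n}\mu_j}{5n}=\frac{(-1)^{3n-1}\alpha_{3n-1}\det(L_S)}{5n}=2^n n\left((\sqrt2+\sqrt3)^{2n}+(\sqrt2-\sqrt3)^{2n}-2\right),$$ and the total number of spanning trees of $P'_n$ is $$\tau(P'_n)=\frac{\prod_{i=2}^{3n}\lambda_i\prod_{j=1}^{2n}\mu'_j}{5n}=\frac{(-1)^{3n-1}\alpha_{3n-1}\det(L'_S)}{5n}=2^n n\left((\sqrt2+\sqrt3)^{2n}+(\sqrt2-\sqrt3)^{2n}+2\right).$$
   Context: For $n\ge2$, the linear pentagonal cylinder graph $P_n$ is the simple graph on the $5n$ vertices $\tilde1,\dots,\tilde n$, $1,\dots,2n$, $1',\dots,(2n)'$ with edges: $\{i,i+1\}$ and $\{i',(i+1)'\}$ for $1\le i\le 2n-1$; $\{2n,1\}$ and $\{(2n)',1'\}$; $\{2k-1,(2k-1)'\}$ for $1\le k\le n$; $\{2k,\tilde k\}$ and $\{\tilde k,(2k)'\}$ for $1\le k\le n$. The pentagonal M\"obius chain graph $P'_n$ has the same vertices and edges except that $\{2n,1\}$ and $\{(2n)',1'\}$ are replaced by $\{2n,1'\}$ and $\{(2n)',1\}$. $\tau(G)$ denotes the number of spanning trees of $G$. Matrices: $L_A$ is the symmetric $3n\times3n$ matrix $\begin{bmatrix}2I_n & \sqrt2\,N\\ \sqrt2\,N^T & C\end{bmatrix}$,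 where $N$ is the $n\times 2n$ matrix with $N_{k,2k}=-1$ for $1\le k\le n$ and all other entries $0$, and $C$ is the symmetric $2n\times2n$ matrix with $C_{ii}=2$ for $i$ odd, $C_{ii}=3$ for $i$ even, $C_{i,i+1}=C_{i+1,i}=-1$ for $1\le i\le 2n-1$, $C_{1,2n}=C_{2n,1}=-1$, and all other entries $0$. $L_S$ (respectively $L'_S$) is the symmetric $2n\times 2n$ matrix with diagonal entries $4$ at odd positions and $3$ at even positions, entries $-1$ at positions $(i,i+1)$ and $(i+1,i)$ for $1\le i\le 2n-1$, entries $-1$ (respectively $+1$) at positions $(1,2n)$ and $(2n,1)$, and $0$ elsewhere. $0=\lambda_1\le\lambda_2\le\cdots\le\lambda_{3n}$ are the eigenvalues of $L_A$, $\mu_1\le\cdots\le\mu_{2n}$ those of $L_S$, and $\mu'_1\le\cdots\le\mu'_{2n}$ those of $L'_S$, with multiplicity. $\alpha_{3n-1}$ is the coefficient of $x$ in $\det(xI_{3n}-L_A)$. *)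

theory Defs
  imports Complex_Main "Jordan_Normal_Form.Char_Poly"
begin

section \<open>Simple graphs and spanning trees\<close>

text \<open>A simple graph is a pair of a vertex set and a set of two-element edges. The tree notions of
  the AFP entry \<open>Graph_Theory\<close> are not used: they concern directed graphs and directed cycles.\<close>

type_synonym 'a sgraph = "'a set \<times> 'a set set"

abbreviation vertices :: "'a sgraph \<Rightarrow> 'a set" where "vertices \<equiv> fst"
abbreviation edges :: "'a sgraph \<Rightarrow> 'a set set" where "edges \<equiv> snd"

definition simple_graph :: "'a sgraph \<Rightarrow> bool" where
  "simple_graph G \<longleftrightarrow> finite (vertices G) \<and> (\<forall>e\<in>edges G. e \<subseteq> vertices G \<and> card e = 2)"

definition connected_graph :: "'a sgraph \<Rightarrow> bool" where
  "connected_graph G \<longleftrightarrow> vertices G \<noteq> {} \<and>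
     (\<forall>u\<in>vertices G. \<forall>v\<in>vertices G. (u, v) \<in> {(x, y). {x, y} \<in> edges G}\<^sup>*)"

definition is_cycle :: "'a sgraph \<Rightarrow> 'a list \<Rightarrow> bool" where
  "is_cycle G vs \<longleftrightarrow> length vs \<ge> 3 \<and> distinct vs \<and>
     (\<forall>i<length vs. {vs ! i, vs ! (Suc i mod length vs)} \<in> edges G)"

definition is_tree :: "'a sgraph \<Rightarrow> bool" where
  "is_tree G \<longleftrightarrow> simple_graph G \<and> connected_graph G \<and> (\<nexists>vs. is_cycle G vs)"

definition spanning_tree :: "'a sgraph \<Rightarrow> 'a sgraph \<Rightarrow> bool" where
  "spanning_tree T G \<longleftrightarrow> vertices T = vertices G \<and> edges T \<subseteq> edges G \<and> is_tree T"

definition num_spanning_trees :: "'a sgraph \<Rightarrow> nat" where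
  "num_spanning_trees G = card {T. spanning_tree T G}"

section \<open>The pentagonal cylinder and the pentagonal Moebius chain\<close>

text \<open>\<open>Tilde k\<close>, \<open>Plain i\<close> and \<open>Prime i\<close> are the vertices written as \<open>k\<close> with a tilde, \<open>i\<close> and \<open>i'\<close>.\<close>

datatype pvertex = Tilde nat | Plain nat | Prime nat

definition pent_vertices :: "nat \<Rightarrow> pvertex set" where
  "pent_vertices n = Tilde ` {1..n} \<union> Plain ` {1..2*n} \<union> Prime ` {1..2*n}"

definition pent_common_edges :: "nat \<Rightarrow> pvertex set set" where
  "pent_common_edges n =
     {{Plain i, Plain (i+1)} | i. i \<in> {1..2*n-1}} \<union>
     {{Prime i, Prime (i+1)} | i. i \<in> {1..2*n-1}} \<union>
     {{Plain (2*k-1), Prime (2*k-1)} | k. k \<in> {1..n}} \<union>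
     {{Plain (2*k), Tilde k} | k. k \<in> {1..n}} \<union>
     {{Tilde k, Prime (2*k)} | k. k \<in> {1..n}}"

definition pent_cylinder :: "nat \<Rightarrow> pvertex sgraph" where
  "pent_cylinder n = (pent_vertices n,
     pent_common_edges n \<union> {{Plain (2*n), Plain 1}, {Prime (2*n), Prime 1}})"

definition pent_moebius :: "nat \<Rightarrow> pvertex sgraph" where
  "pent_moebius n = (pent_vertices n,
     pent_common_edges n \<union> {{Plain (2*n), Prime 1}, {Prime (2*n), Plain 1}})"

section \<open>Matrices\<close>

text \<open>Library matrices are indexed from 0; \<open>mat1 nr nc f\<close> has the entry \<open>f i j\<close> in row \<open>i\<close> and
  column \<open>j\<close> counted from 1.\<close>

definition mat1 :: "nat \<Rightarrow> nat \<Rightarrow> (nat \<Rightarrow> nat \<Rightarrow> real) \<Rightarrow> real mat" where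
  "mat1 nr nc f = mat nr nc (\<lambda>(i, j). f (i+1) (j+1))"

definition N_mat :: "nat \<Rightarrow> real mat" where
  "N_mat n = mat1 n (2*n) (\<lambda>k j. if j = 2*k then -1 else 0)"

definition C_mat :: "nat \<Rightarrow> real mat" where
  "C_mat n = mat1 (2*n) (2*n) (\<lambda>i j.
     if i = j then (if odd i then 2 else 3)
     else if j = i+1 \<or> i = j+1 then -1
     else if (i, j) = (1, 2*n) \<or> (i, j) = (2*n, 1) then -1
     else 0)"

definition LA :: "nat \<Rightarrow> real mat" where
  "LA n = four_block_mat
     (2 \<cdot>\<^sub>m 1\<^sub>m n)                  (sqrt 2 \<cdot>\<^sub>m N_mat n)
     (sqrt 2 \<cdot>\<^sub>m transpose_mat (N_mat n))  (C_mat n)"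

definition LS_corner :: "real \<Rightarrow> nat \<Rightarrow> real mat" where
  "LS_corner c n = mat1 (2*n) (2*n) (\<lambda>i j.
     if i = j then (if odd i then 4 else 3)
     else if j = i+1 \<or> i = j+1 then -1
     else if (i, j) = (1, 2*n) \<or> (i, j) = (2*n, 1) then c
     else 0)"

definition LS :: "nat \<Rightarrow> real mat" where
  "LS n = LS_corner (-1) n"

definition LS' :: "nat \<Rightarrow> real mat" where
  "LS' n = LS_corner 1 n"

section \<open>Eigenvalues in increasing order\<close>

definition sorted_eigenvalues :: "real mat \<Rightarrow> real list" where
  "sorted_eigenvalues A = sorted_list_of_multiset (proots (char_poly A))"

text \<open>The \<open>i\<close>-th smallest eigenvalue, counted from 1 and with multiplicity. The lemma
  \<open>length_sorted_eigenvalues\<close> below shows that it is meaningful for all \<open>1 \<le> i \<le> n\<close>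
  if the matrix is symmetric of size \<open>n\<close>.\<close>

definition eigval :: "real mat \<Rightarrow> nat \<Rightarrow> real" where
  "eigval A i = sorted_eigenvalues A ! (i - 1)"

lemma symmetric_complex_eigenvalue_real:
  fixes A :: "real mat"
  assumes A: "A \<in> carrier_mat n n" and sym: "transpose_mat A = A"
    and ev: "eigenvalue (map_mat complex_of_real A) a"
  shows "a \<in> \<real>"
proof -
  have A_sym: "A $$ (i, j) = A $$ (j, i)" if "i < n" "j < n" for i j
    using A that by (subst (1) sym[symmetric]) simp
  from ev A obtain v where v: "v \<in> carrier_vec n" "v \<noteq> 0\<^sub>v n"
    and eq: "map_mat complex_of_real A *\<^sub>v v = a \<cdot>\<^sub>v v"
    unfolding eigenvalue_def eigenvector_def by auto
  have row: "(\<Sum>j<n. of_real (A $$ (i, j)) * v $ j) = a * v $ i" if "i < n" for i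
  proof -
    have "(map_mat complex_of_real A *\<^sub>v v) $ i = (a \<cdot>\<^sub>v v) $ i"
      by (simp add: eq)
    then show ?thesis
      using A v that by (simp add: scalar_prod_def atLeast0LessThan)
  qed
  define q where "q = (\<Sum>i<n. \<Sum>j<n. cnj (v $ i) * (of_real (A $$ (i, j)) * v $ j))"
  define r where "r = (\<Sum>i<n. (cmod (v $ i))\<^sup>2)"
  have "q = (\<Sum>i<n. cnj (v $ i) * (a * v $ i))"
    unfolding q_def by (intro sum.cong refl) (simp add: row flip: sum_distrib_left)
  also have "\<dots> = a * of_real r"
    by (simp add: r_def sum_distrib_left complex_norm_square ac_simps del: of_real_power)
  finally have q: "q = a * of_real r" .
  have "cnj q = (\<Sum>i<n. \<Sum>j<n. v $ i * (of_real (A $$ (i, j)) * cnj (v $ j)))"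
    by (simp add: q_def)
  also have "\<dots> = (\<Sum>j<n. \<Sum>i<n. v $ i * (of_real (A $$ (i, j)) * cnj (v $ j)))"
    by (rule sum.swap)
  also have "\<dots> = q"
    unfolding q_def by (intro sum.cong refl) (simp add: A_sym ac_simps)
  finally have "cnj a * of_real r = a * of_real r"
    by (simp add: q)
  moreover obtain i where "i < n" "v $ i \<noteq> 0"
    using v by (metis carrier_vecD eq_vecI index_zero_vec)
  then have "r > 0"
    unfolding r_def by (intro sum_pos2[of _ i]) auto
  ultimately show ?thesis
    by (simp add: Reals_cnj_iff)
qed

lemma symmetric_char_poly_splits:
  fixes A :: "real mat"
  assumes A: "A \<in> carrier_mat n n" and sym: "transpose_mat A = A"
  obtains as where "char_poly A = (\<Prod>a\<leftarrow>as. [:- a, 1:])" and "length as = n"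
proof -
  let ?B = "map_mat complex_of_real A"
  have B: "?B \<in> carrier_mat n n"
    using A by simp
  from char_poly_factorized[OF B] obtain as
    where as: "char_poly ?B = (\<Prod>a\<leftarrow>as. [:- a, 1:])" "length as = n"
    by blast
  have "a \<in> \<real>" if "a \<in> set as" for a
  proof -
    have "poly (char_poly ?B) a = 0"
      unfolding as(1) poly_prod_list using that by (auto simp: prod_list_zero_iff)
    then show ?thesis
      using symmetric_complex_eigenvalue_real[OF A sym] eigenvalue_root_char_poly[OF B] by blast
  qed
  then have "map_poly of_real (\<Prod>a\<leftarrow>map Re as. [:- a, 1:]) = (\<Prod>a\<leftarrow>as. [:- a, 1:])"
  proof (induction as)
    case (Cons b bs)
    interpret map_poly_comm_ring_hom "of_real :: real \<Rightarrow> complex" ..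
    have "map_poly of_real [:- Re b, 1:] = [:- b, 1:]"
      using Cons.prems by (simp add: map_poly_pCons complex_is_Real_iff complex_eq_iff)
    then show ?case
      using Cons by (simp add: hom_mult del: mult_pCons_left)
  qed simp
  also have "\<dots> = map_poly of_real (char_poly A)"
    using as(1) of_real_hom.char_poly_hom[OF A, where 'a = complex] by simp
  finally have "char_poly A = (\<Prod>a\<leftarrow>map Re as. [:- a, 1:])"
    by (simp add: poly_eq_iff coeff_map_poly)
  with as(2) show thesis
    by (intro that[of "map Re as"]) simp_all
qed

lemma length_sorted_eigenvalues:
  fixes A :: "real mat"
  assumes "A \<in> carrier_mat n n" and "transpose_mat A = A"
  shows "length (sorted_eigenvalues A) = n"
proof -
  obtain as where as: "char_poly A = (\<Prod>a\<leftarrow>as. [:- a, 1:])" "length as = n"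
    using symmetric_char_poly_splits[OF assms] .
  have "proots (\<Prod>a\<leftarrow>as. [:- a, 1:]) = mset as"
  proof (induction as)
    case (Cons b bs)
    have "(\<Prod>a\<leftarrow>bs. [:- a, 1:]) \<noteq> 0"
      by (auto simp: prod_list_zero_iff)
    then have "proots ([:- b, 1:] * (\<Prod>a\<leftarrow>bs. [:- a, 1:])) = {#b#} + mset bs"
      using Cons.IH by (subst proots_mult) simp_all
    then show ?case
      by simp
  qed simp
  then have "mset (sorted_eigenvalues A) = mset as"
    by (simp add: sorted_eigenvalues_def as(1))
  then show ?thesis
    using as(2) by (metis size_mset)
qed

lemma C_mat_carrier: "C_mat n \<in> carrier_mat (2*n) (2*n)"
  and C_mat_symmetric: "transpose_mat (C_mat n) = C_mat n"
  by (auto simp: C_mat_def mat1_def)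

lemma LA_carrier: "LA n \<in> carrier_mat (3*n) (3*n)"
  by (auto simp: LA_def C_mat_def mat1_def)

lemma LA_symmetric: "transpose_mat (LA n) = LA n"
  by (rule eq_matI) (auto simp: LA_def C_mat_def N_mat_def mat1_def)

lemma LS_carrier: "LS n \<in> carrier_mat (2*n) (2*n)"
  and LS'_carrier: "LS' n \<in> carrier_mat (2*n) (2*n)"
  and LS_symmetric: "transpose_mat (LS n) = LS n"
  and LS'_symmetric: "transpose_mat (LS' n) = LS' n"
  by (auto simp: LS_def LS'_def LS_corner_def mat1_def)

end

theory Submission
  imports Defs
begin

text \<open>
  By the matrix tree theorem, every principal minor of size \<open>5 * n - 1\<close> of the Laplacian \<open>L\<close> of a
  pentagonal chain is the number \<open>\<tau>\<close> of spanning trees. Hence the coefficient of \<open>x\<close> in the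
  characteristic polynomial of \<open>L\<close> is \<open>5 * n * \<tau>\<close> up to sign. The reflection that exchanges
  \<open>i\<close> and \<open>i'\<close> commutes with \<open>L\<close>; on symmetric vectors \<open>L\<close> acts as \<open>LA n\<close> and on antisymmetric ones
  as \<open>LS n\<close> or \<open>LS' n\<close>. So the characteristic polynomial of \<open>L\<close> is a product of two
  (lemma \<open>char_poly_laplacian_pent\<close>), and as \<open>LA n\<close> is singular, the coefficient of \<open>x\<close> in it is that
  of \<open>LA n\<close> times the determinant of the second factor. This is the second formula for \<open>\<tau>\<close>, and the
  first one rewrites it in terms of eigenvalues.

  For the matrix tree theorem (\<open>det_grounded_laplacian\<close>), let \<open>R\<close> be a set of roots. The determinant
  of the Laplacian without the rows and columns in \<open>R\<close> counts the edge sets that connect every vertex to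
  \<open>R\<close> with one edge per vertex outside \<open>R\<close>. Both numbers satisfy a deletion-contraction
  recurrence for an edge that joins a vertex \<open>u\<close> to a root; contracting this edge amounts to making \<open>u\<close> a
  root too. For a single root, these edge sets are the spanning trees.

  For the closed form, both spectra are reduced to a cyclic tridiagonal matrix of size \<open>2 * n\<close> whose
  diagonal alternates between two values \<open>a\<close> and \<open>b\<close>. If its other entries are \<open>-1\<close> next to the diagonal
  and \<open>c\<close>, with \<open>c\<^sup>2 = 1\<close>, in the corners, then its determinant is \<open>V\<^sub>n(a * b - 2) + 2 * c\<close>, where \<open>V\<^sub>n\<close>
  is a Vieta--Lucas polynomial (\<open>det_cyclic_alternating\<close>). For \<open>LS n\<close> and \<open>LS' n\<close>
  this gives \<open>V\<^sub>n(10) \<mp> 2\<close>, and \<open>V\<^sub>n(10)\<close> is the sum of the \<open>2 * n\<close>-th powers of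
  \<open>sqrt 2 \<plusminus> sqrt 3\<close>, as the squares of these two numbers have sum 10 and product 1. For \<open>LA n\<close>,
  eliminating the first block gives the characteristic polynomial
  \<open>(x - 2)\<^sup>n * (V\<^sub>n(x\<^sup>2 - 5 * x + 2) - 2)\<close>. Its coefficient of \<open>x\<close> follows from \<open>V\<^sub>n(2) = 2\<close> and
  \<open>V\<^sub>n'(2) = n\<^sup>2\<close>, and its roots are nonnegative because \<open>V\<^sub>n(u) > 2\<close> for \<open>u > 2\<close>; so \<open>\<lambda>\<^sub>1 = 0\<close> is
  the least eigenvalue.
\<close>

section \<open>Edge sets that connect every vertex to a root set\<close>

definition adj :: "'a set set \<Rightarrow> ('a \<times> 'a) set" where
  "adj F = {(x, y). {x, y} \<in> F}"

text \<open>Allowing a set \<open>R\<close> of roots instead of a single one replaces the contraction of an edge \<open>{u, r}\<close>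
  with \<open>r \<in> R\<close> by the enlargement of \<open>R\<close> to \<open>insert u R\<close>, so that no quotient graph is ever formed.\<close>

definition spans :: "'a set \<Rightarrow> 'a set set \<Rightarrow> 'a set \<Rightarrow> bool" where
  "spans V F R \<longleftrightarrow> (\<forall>v\<in>V. \<exists>r\<in>R. (v, r) \<in> (adj F)\<^sup>*)"

lemma adj_mono: "F \<subseteq> F' \<Longrightarrow> adj F \<subseteq> adj F'"
  by (auto simp: adj_def)

lemma sym_adj: "sym (adj F)"
  by (auto simp: sym_def adj_def insert_commute)

lemma adj_rtrancl_sym: "(x, y) \<in> (adj F)\<^sup>* \<Longrightarrow> (y, x) \<in> (adj F)\<^sup>*"
  using sym_adj by (metis sym_rtrancl symD)

lemma spans_mono: "spans V F R \<Longrightarrow> F \<subseteq> F' \<Longrightarrow> R \<subseteq> R' \<Longrightarrow> spans V F' R'"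
  unfolding spans_def using rtrancl_mono[OF adj_mono, of F F'] by blast

text \<open>The last step into \<open>R\<close> of a walk that starts outside \<open>R\<close> uses such an edge.\<close>

lemma spans_crossing_edge:
  assumes "spans V F R" "R \<subset> V" "\<forall>e\<in>F. e \<subseteq> V"
  obtains u r where "u \<in> V - R" "r \<in> R" "{u, r} \<in> F"
proof -
  obtain v where v: "v \<in> V - R" using assms(2) by blast
  then obtain r where r: "r \<in> R" "(v, r) \<in> (adj F)\<^sup>*"
    using assms(1) by (auto simp: spans_def)
  have "\<exists>u r. u \<in> V - R \<and> r \<in> R \<and> {u, r} \<in> F"
    using r(2) v
  proof (induction rule: converse_rtrancl_induct)
    case base
    then show ?case using r(1) by blast
  next
    case (step y z)
    then have "{y, z} \<in> F" by (simp add: adj_def)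
    moreover from this have "z \<in> V" using assms(3) by blast
    ultimately show ?case using step by blast
  qed
  then show thesis using that by blast
qed

text \<open>Contraction in disguise: a walk that reaches \<open>R\<close> through \<open>{u, r}\<close> has already met \<open>u\<close> or \<open>r\<close>
  when it first uses that edge, and conversely \<open>u\<close> is one step away from \<open>R\<close>.\<close>

lemma spans_remove_crossing_edge:
  assumes "r \<in> R"
  shows "spans V (insert {u, r} F) R \<longleftrightarrow> spans V F (insert u R)"
proof
  assume L: "spans V (insert {u, r} F) R"
  show "spans V F (insert u R)"
    unfolding spans_def
  proof
    fix v assume "v \<in> V"
    then obtain s where s: "s \<in> R" "(v, s) \<in> (adj (insert {u, r} F))\<^sup>*"
      using L by (auto simp: spans_def)
    from s(2) show "\<exists>t\<in>insert u R. (v, t) \<in> (adj F)\<^sup>*"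
    proof (induction rule: converse_rtrancl_induct)
      case base
      then show ?case using s(1) by blast
    next
      case (step y z)
      show ?case
      proof (cases "{y, z} = {u, r}")
        case True
        then have "y \<in> insert u R" using assms by (auto simp: doubleton_eq_iff)
        then show ?thesis by blast
      next
        case False
        then have "(y, z) \<in> adj F" using step.hyps by (auto simp: adj_def)
        then show ?thesis using step.IH by (meson converse_rtrancl_into_rtrancl)
      qed
    qed
  qed
next
  assume "spans V F (insert u R)"
  then have R: "spans V (insert {u, r} F) (insert u R)"
    by (rule spans_mono) auto
  have "(u, r) \<in> (adj (insert {u, r} F))\<^sup>*"
    by (auto simp: adj_def)
  then show "spans V (insert {u, r} F) R"
    using R assms unfolding spans_def by (metis insert_iff rtrancl_trans)
qed

text \<open>Each crossing edge that is removed turns one vertex into a root, so exactly one edge is needed for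
  each vertex outside \<open>R\<close>. This gives both the lower bound on the size of a spanning set and the
  existence of one that attains it.\<close>

lemma spans_minimal:
  assumes "spans V F R" "R \<subseteq> V" "finite V" "finite F" "\<forall>e\<in>F. e \<subseteq> V"
  shows "\<exists>T\<subseteq>F. spans V T R \<and> card T = card (V - R)"
  using assms
proof (induction "card (V - R)" arbitrary: F R)
  case 0
  then have "R = V" by auto
  then have "spans V {} R" by (auto simp: spans_def)
  then show ?case using 0 by (intro exI[of _ "{}"]) auto
next
  case (Suc k)
  then have "R \<subset> V" by (metis Diff_cancel card.empty nat.distinct(1) psubsetI)
  then obtain u r where ur: "u \<in> V - R" "r \<in> R" "{u, r} \<in> F"
    using spans_crossing_edge Suc.prems by metis
  have k: "k = card (V - insert u R)"
    using Suc.hyps(2) ur(1) \<open>finite V\<close> by (metis Diff_insert card_Diff_singleton diff_Suc_1)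
  have "spans V (F - {{u, r}}) (insert u R)"
    using Suc.prems(1) ur by (metis insert_Diff spans_remove_crossing_edge)
  with Suc.hyps(1)[OF k, of "F - {{u, r}}"] Suc.prems ur
  obtain T where T: "T \<subseteq> F - {{u, r}}" "spans V T (insert u R)" "card T = card (V - insert u R)"
    by auto
  have "finite T" using T(1) Suc.prems(4) by (meson finite_Diff finite_subset)
  then have "card (insert {u, r} T) = card (V - R)"
    using T k Suc.hyps(2) by (metis Diff_iff card_insert_disjoint insertI1 subsetD)
  then show ?case
    using T ur by (intro exI[of _ "insert {u, r} T"]) (auto simp: spans_remove_crossing_edge)
qed

lemma spans_delete_cycle_edge:
  assumes "spans V F R" "e = {a, b}" "(a, b) \<in> (adj (F - {e}))\<^sup>*"
  shows "spans V (F - {e}) R"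
proof -
  have "adj F \<subseteq> (adj (F - {e}))\<^sup>*"
    using assms(2,3) adj_rtrancl_sym[OF assms(3)] by (auto simp: adj_def doubleton_eq_iff)
  then have "(adj F)\<^sup>* \<subseteq> (adj (F - {e}))\<^sup>*"
    by (metis rtrancl_idemp rtrancl_mono)
  then show ?thesis using assms(1) unfolding spans_def by blast
qed

lemma rtrancl_distinct_path:
  assumes "(a, b) \<in> r\<^sup>*"
  obtains vs where "vs \<noteq> []" "hd vs = a" "last vs = b" "distinct vs"
    "\<forall>i. Suc i < length vs \<longrightarrow> (vs ! i, vs ! Suc i) \<in> r"
proof -
  have "\<exists>vs. vs \<noteq> [] \<and> hd vs = a \<and> last vs = b \<and> distinct vs \<and>
     (\<forall>i. Suc i < length vs \<longrightarrow> (vs ! i, vs ! Suc i) \<in> r)"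
    using assms
  proof (induction rule: converse_rtrancl_induct)
    case base
    show ?case by (intro exI[of _ "[b]"]) auto
  next
    case (step y z)
    then obtain vs where vs: "vs \<noteq> []" "hd vs = z" "last vs = b" "distinct vs"
     "\<forall>i. Suc i < length vs \<longrightarrow> (vs ! i, vs ! Suc i) \<in> r" by blast
    show ?case
    proof (cases "y \<in> set vs")
      case True
      then obtain k where k: "k < length vs" "vs ! k = y" by (auto simp: in_set_conv_nth)
      \<comment> \<open>The walk returns to \<open>y\<close>: the loop is cut off.\<close>
      show ?thesis
        using vs k by (intro exI[of _ "drop k vs"]) (auto simp: hd_drop_conv_nth)
    next
      case False
      have "(((y # vs) ! i), (y # vs) ! Suc i) \<in> r" if "Suc i < length (y # vs)" for i
        using that vs step.hyps(1) by (cases i) (auto simp: hd_conv_nth)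
      then show ?thesis
        using vs False by (intro exI[of _ "y # vs"]) auto
    qed
  qed
  then show thesis using that by blast
qed

lemma cycle_through_edge:
  assumes "e \<in> F" "e = {a, b}" "a \<noteq> b" "(a, b) \<in> (adj (F - {e}))\<^sup>*"
  shows "\<exists>vs. is_cycle (V, F) vs"
proof -
  obtain vs where vs: "vs \<noteq> []" "hd vs = a" "last vs = b" "distinct vs"
    "\<forall>i. Suc i < length vs \<longrightarrow> (vs ! i, vs ! Suc i) \<in> adj (F - {e})"
    using rtrancl_distinct_path[OF assms(4)] by metis
  have h: "vs ! 0 = a" "vs ! (length vs - 1) = b"
    using vs by (auto simp: hd_conv_nth last_conv_nth)
  have "length vs \<noteq> 1" using h assms(3) by auto
  moreover have "length vs \<noteq> 2"
  proof
    assume "length vs = 2"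
    then have "(a, b) \<in> adj (F - {e})" using vs(5)[rule_format, of 0] h by simp
    then show False using assms(2) by (simp add: adj_def)
  qed
  ultimately have len: "length vs \<ge> 3"
    using vs(1) by (cases "length vs" rule: nat.exhaust) auto
  have "{vs ! i, vs ! (Suc i mod length vs)} \<in> F" if "i < length vs" for i
  proof (cases "Suc i < length vs")
    case True
    then show ?thesis using vs(5) by (auto simp: adj_def)
  next
    case False
    then have "Suc i = length vs" using that by simp
    then have "i = length vs - 1" "Suc i mod length vs = 0" by auto
    then show ?thesis using h assms by (simp add: insert_commute)
  qed
  then show ?thesis using len vs by (auto simp: is_cycle_def)
qed

lemma cycle_edge_bypass:
  assumes "is_cycle (V, F) vs"
  obtains a b where "{a, b} \<in> F" "(a, b) \<in> (adj (F - {{a, b}}))\<^sup>*"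
proof -
  define m where "m = length vs"
  have m: "m \<ge> 3" and d: "distinct vs"
    and E: "\<And>i. i < m \<Longrightarrow> {vs ! i, vs ! (Suc i mod m)} \<in> F"
    using assms by (auto simp: is_cycle_def m_def)
  let ?e = "{vs ! 0, vs ! (m - 1)}"
  have step: "(vs ! i, vs ! Suc i) \<in> adj (F - {?e})" if "Suc i < m" for i
  proof -
    have "{vs ! i, vs ! Suc i} \<in> F" using E[of i] that by simp
    moreover have "{vs ! i, vs ! Suc i} \<noteq> ?e"
    proof
      assume "{vs ! i, vs ! Suc i} = ?e"
      moreover have "vs ! j = vs ! k \<longleftrightarrow> j = k" if "j < m" "k < m" for j k
        using d that by (simp add: nth_eq_iff_index_eq m_def)
      ultimately show False
        using that m by (auto simp: doubleton_eq_iff)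
    qed
    ultimately show ?thesis by (simp add: adj_def)
  qed
  have "(vs ! 0, vs ! i) \<in> (adj (F - {?e}))\<^sup>*" if "i < m" for i
    using that
  proof (induction i)
    case (Suc i)
    then show ?case using step[of i] by (meson Suc_lessD rtrancl.rtrancl_into_rtrancl)
  qed simp
  then have "(vs ! 0, vs ! (m - 1)) \<in> (adj (F - {?e}))\<^sup>*" using m by simp
  moreover have "?e \<in> F"
    using E[of "m - 1"] m by (simp add: insert_commute)
  ultimately show thesis using that by blast
qed

text \<open>Deleting an edge \<open>{a, b}\<close> keeps a spanning set spanning if \<open>a\<close> and \<open>b\<close> stay connected, that is, if
  the edge lies on a cycle. So a connected graph is acyclic iff it is a minimal spanning edge set, and
  by the preceding extraction of spanning subsets of the least size, minimality is a statement about the number of edges.\<close>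

lemma is_tree_iff_spans_card:
  assumes G: "simple_graph (V, F)" and r: "r \<in> V"
  shows "is_tree (V, F) \<longleftrightarrow> spans V F {r} \<and> card F = card V - 1"
proof -
  have fin: "finite V" "\<forall>e\<in>F. e \<subseteq> V" "\<forall>e\<in>F. card e = 2"
    using G by (auto simp: simple_graph_def)
  then have finF: "finite F" by (meson PowI finite_Pow_iff rev_finite_subset subsetI)
  have card: "card (V - {r}) = card V - 1" using r by simp
  have conn: "connected_graph (V, F) \<longleftrightarrow> spans V F {r}"
  proof
    assume "spans V F {r}"
    then have *: "(v, r) \<in> (adj F)\<^sup>*" if "v \<in> V" for v using that by (auto simp: spans_def)
    then have "(u, v) \<in> (adj F)\<^sup>*" if "u \<in> V" "v \<in> V" for u v
      using that by (meson adj_rtrancl_sym rtrancl_trans)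
    then show "connected_graph (V, F)"
      using r by (auto simp: connected_graph_def adj_def)
  qed (use r in \<open>auto simp: connected_graph_def spans_def adj_def\<close>)
  have "(\<nexists>vs. is_cycle (V, F) vs) \<longleftrightarrow> card F = card V - 1" if S: "spans V F {r}"
  proof
    assume acyc: "\<nexists>vs. is_cycle (V, F) vs"
    obtain T where T: "T \<subseteq> F" "spans V T {r}" "card T = card V - 1"
      using spans_minimal[OF S _ fin(1) finF fin(2)] r card by auto
    have "T = F"
    proof (rule ccontr)
      assume "T \<noteq> F"
      then obtain e where e: "e \<in> F" "e \<notin> T" using T(1) by blast
      then obtain a b where ab: "e = {a, b}" "a \<noteq> b" using fin(3) by (meson card_2_iff)
      have "spans V (F - {e}) {r}" using T e by (auto intro: spans_mono[of V T])
      then have *: "(v, r) \<in> (adj (F - {e}))\<^sup>*" if "v \<in> V" for v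
        using that by (auto simp: spans_def)
      have "a \<in> V" "b \<in> V" using fin(2) e ab by auto
      then have "(a, b) \<in> (adj (F - {e}))\<^sup>*"
        using * by (meson adj_rtrancl_sym rtrancl_trans)
      then show False using cycle_through_edge[OF e(1) ab] acyc by blast
    qed
    then show "card F = card V - 1" using T by simp
  next
    assume c: "card F = card V - 1"
    show "\<nexists>vs. is_cycle (V, F) vs"
    proof
      assume "\<exists>vs. is_cycle (V, F) vs"
      then obtain a b where ab: "{a, b} \<in> F" "(a, b) \<in> (adj (F - {{a, b}}))\<^sup>*"
        using cycle_edge_bypass by metis
      then have "spans V (F - {{a, b}}) {r}" using S spans_delete_cycle_edge by metis
      then obtain T where "T \<subseteq> F - {{a, b}}" "card T = card V - 1"
        using spans_minimal[of V "F - {{a, b}}" "{r}"] r card fin finF by auto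
      then have "T \<subset> F" "card T = card F" using c ab(1) by auto
      then show False using finF psubset_card_mono by (metis less_irrefl)
    qed
  qed
  then show ?thesis using conn G by (auto simp: is_tree_def)
qed

lemma num_spanning_trees_eq_card_spans:
  assumes G: "simple_graph (V, E)" and r: "r \<in> V"
  shows "num_spanning_trees (V, E) = card {T. T \<subseteq> E \<and> spans V T {r} \<and> card T = card (V - {r})}"
proof -
  have sub: "simple_graph (V, T)" if "T \<subseteq> E" for T
    using G that by (auto simp: simple_graph_def)
  have "{T. spanning_tree T (V, E)} =
      Pair V ` {T. T \<subseteq> E \<and> spans V T {r} \<and> card T = card (V - {r})}"
    using is_tree_iff_spans_card[OF sub r] r
    by (fastforce simp: spanning_tree_def image_iff)
  then show ?thesis
    unfolding num_spanning_trees_def by (simp add: card_image inj_on_def)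
qed

lemma cofactor_diag: "cofactor A u u = det (mat_delete A u u)"
  by (simp add: cofactor_def)

section \<open>The matrix tree theorem\<close>

lemma det_add_diagonal_unit:
  fixes A B :: "'a :: comm_ring_1 mat"
  assumes A: "A \<in> carrier_mat n n" and B: "B \<in> carrier_mat n n" and u: "u < n"
    and AB: "\<And>i j. i < n \<Longrightarrow> j < n \<Longrightarrow> B $$ (i, j) = A $$ (i, j) + of_bool (i = u \<and> j = u)"
  shows "det B = det A + det (mat_delete A u u)"
proof -
  have "mat_delete B u j = mat_delete A u j" if "j < n" for j
    using A B by (intro eq_matI) (auto simp: mat_delete_def AB)
  then have c: "cofactor B u j = cofactor A u j" if "j < n" for j
    using that by (simp add: cofactor_def)
  have "det B = (\<Sum>j<n. B $$ (u, j) * cofactor B u j)"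
    by (rule laplace_expansion_row[OF B u])
  also have "\<dots> = (\<Sum>j<n. A $$ (u, j) * cofactor A u j + (if j = u then cofactor A u j else 0))"
    by (intro sum.cong) (auto simp: AB u c algebra_simps)
  also have "\<dots> = (\<Sum>j<n. A $$ (u, j) * cofactor A u j) + cofactor A u u"
    using u by (simp add: sum.distrib)
  finally show ?thesis
    by (simp add: laplace_expansion_row[OF A u] cofactor_diag)
qed

lemma det_unit_row:
  fixes A :: "'a :: comm_ring_1 mat"
  assumes A: "A \<in> carrier_mat n n" and u: "u < n"
    and row: "\<And>j. j < n \<Longrightarrow> A $$ (u, j) = of_bool (j = u)"
  shows "det A = det (mat_delete A u u)"
proof -
  have "det A = (\<Sum>j<n. if j = u then cofactor A u j else 0)"
    unfolding laplace_expansion_row[OF A u] by (intro sum.cong) (auto simp: row)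
  then show ?thesis
    using u by (simp add: cofactor_diag)
qed

text \<open>The Laplacian of the edge set \<open>F\<close> for the vertex enumeration \<open>v\<close>. Rows and columns that belong to
  \<open>R\<close> are overwritten by those of the identity instead of being deleted: the determinant is that of the
  Laplacian without these rows and columns, but the size does not change when \<open>R\<close> grows.\<close>

definition grounded_laplacian :: "nat \<Rightarrow> (nat \<Rightarrow> 'a) \<Rightarrow> 'a set set \<Rightarrow> 'a set \<Rightarrow> real mat" where
  "grounded_laplacian N v F R = mat N N (\<lambda>(i, j).
     if v i \<in> R \<or> v j \<in> R then of_bool (i = j)
     else if i = j then real (card {w. {v i, w} \<in> F})
     else - of_bool ({v i, v j} \<in> F))"

lemma grounded_laplacian_carrier: "grounded_laplacian N v F R \<in> carrier_mat N N"
  by (simp add: grounded_laplacian_def)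

text \<open>If no edge joins \<open>R\<close> to its complement, then the row sums over the complement vanish, and the
  indicator vector of the complement is in the kernel.\<close>

lemma det_grounded_laplacian_no_crossing:
  assumes v: "bij_betw v {..<N} V" and R: "R \<subset> V" and F: "\<forall>e\<in>F. e \<subseteq> V \<and> card e = 2"
    and nc: "\<And>u r. u \<in> V - R \<Longrightarrow> r \<in> R \<Longrightarrow> {u, r} \<notin> F"
  shows "det (grounded_laplacian N v F R) = 0"
proof -
  let ?M = "grounded_laplacian N v F R"
  let ?x = "vec N (\<lambda>i. of_bool (v i \<notin> R)) :: real vec"
  have "?M *\<^sub>v ?x = 0\<^sub>v N"
  proof (rule eq_vecI)
    fix i assume "i < dim_vec (0\<^sub>v N :: real vec)"
    then have i: "i < N" by simp
    have S: "(?M *\<^sub>v ?x) $ i = (\<Sum>j<N. ?M $$ (i, j) * of_bool (v j \<notin> R))"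
      using i by (simp add: grounded_laplacian_def scalar_prod_def atLeast0LessThan)
    show "(?M *\<^sub>v ?x) $ i = 0\<^sub>v N $ i"
    proof (cases "v i \<in> R")
      case True
      then have "(\<Sum>j<N. ?M $$ (i, j) * of_bool (v j \<notin> R)) = 0"
        using i by (intro sum.neutral) (auto simp: grounded_laplacian_def)
      then show ?thesis using S i by simp
    next
      case False
      then have vi: "v i \<in> V - R" using i v by (auto simp: bij_betw_def)
      let ?W = "{w. {v i, w} \<in> F}"
      have W: "?W \<subseteq> V - R" "v i \<notin> ?W"
        using F nc[OF vi] by auto
      have term_eq: "?M $$ (i, j) * of_bool (v j \<notin> R) =
          (if j = i then real (card ?W) else 0) - of_bool (v j \<in> ?W)" if "j < N" for j
        using i that False W by (auto simp: grounded_laplacian_def)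
      have "bij_betw v {j \<in> {..<N}. v j \<in> ?W} ?W"
        using W(1) v by (auto simp: bij_betw_def inj_on_def)
      then have "card {j \<in> {..<N}. v j \<in> ?W} = card ?W"
        by (rule bij_betw_same_card)
      then have "(\<Sum>j<N. of_bool (v j \<in> ?W)) = real (card ?W)"
        by (simp add: sum_of_bool_eq Int_def conj_commute)
      then have "(\<Sum>j<N. ?M $$ (i, j) * of_bool (v j \<notin> R)) = 0"
        using i by (simp add: term_eq sum_subtractf)
      then show ?thesis using S i by simp
    qed
  qed (simp add: grounded_laplacian_def)
  moreover obtain i where "i < N" "v i \<notin> R"
    using R v by (auto simp: bij_betw_def)
  then have "?x $ i \<noteq> 0\<^sub>v N $ i" by simp
  then have "?x \<noteq> 0\<^sub>v N" by auto
  ultimately show ?thesis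
    unfolding det_0_iff_vec_prod_zero[OF grounded_laplacian_carrier] by (intro exI[of _ ?x]) simp
qed

text \<open>Deletion and contraction for determinants: as \<open>r\<close> is grounded, the edge \<open>{u, r}\<close> contributes only 1
  to the diagonal entry of \<open>u\<close>, and expanding along row \<open>u\<close> splits off the minor without \<open>u\<close>, in which
  \<open>u\<close> is grounded as well.\<close>

lemma det_grounded_laplacian_crossing:
  assumes v: "bij_betw v {..<N} V" and F: "finite V" "\<forall>e\<in>F. e \<subseteq> V \<and> card e = 2"
    and ur: "u \<in> V - R" "r \<in> R" "{u, r} \<in> F"
  shows "det (grounded_laplacian N v F R) =
    det (grounded_laplacian N v (F - {{u, r}}) R) + det (grounded_laplacian N v (F - {{u, r}}) (insert u R))"
proof -
  let ?F = "F - {{u, r}}"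
  let ?M = "grounded_laplacian N v"
  obtain k where k: "k < N" "v k = u" using v ur(1) by (auto simp: bij_betw_def)
  have inj: "v i = v j \<longleftrightarrow> i = j" if "i < N" "j < N" for i j
    using v that by (auto simp: bij_betw_def inj_on_def)
  have deg: "card {w. {x, w} \<in> F} = card {w. {x, w} \<in> ?F} + of_bool (x = u)" if "x \<notin> R" for x
  proof (cases "x = u")
    case True
    have "{w. {x, w} \<in> F} = insert r {w. {x, w} \<in> ?F}"
      using ur True by (auto simp: doubleton_eq_iff)
    moreover have "r \<notin> {w. {x, w} \<in> ?F}" using True by simp
    moreover have "finite {w. {x, w} \<in> ?F}"
      by (rule finite_subset[OF _ F(1)]) (use F(2) in auto)
    ultimately show ?thesis using True by simp
  next
    case False
    then have "{x, w} \<noteq> {u, r}" for w using that ur by (auto simp: doubleton_eq_iff)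
    then show ?thesis using False by simp
  qed
  have "det (?M F R) = det (?M ?F R) + det (mat_delete (?M ?F R) k k)"
  proof (rule det_add_diagonal_unit[OF grounded_laplacian_carrier grounded_laplacian_carrier k(1)])
    fix i j assume ij: "i < N" "j < N"
    have "of_bool ({v i, v j} \<in> F) = (of_bool ({v i, v j} \<in> ?F) :: real)" if "v i \<notin> R" "v j \<notin> R"
      using that ur by (auto simp: doubleton_eq_iff)
    then show "?M F R $$ (i, j) = ?M ?F R $$ (i, j) + of_bool (i = k \<and> j = k)"
      using ij k ur inj by (auto simp: grounded_laplacian_def deg)
  qed
  moreover have "det (?M ?F (insert u R)) = det (mat_delete (?M ?F (insert u R)) k k)"
    by (rule det_unit_row[OF grounded_laplacian_carrier k(1)])
      (use k in \<open>auto simp: grounded_laplacian_def\<close>)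
  moreover have "mat_delete (?M ?F (insert u R)) k k = mat_delete (?M ?F R) k k"
  proof -
    have "v i \<noteq> u" if "i \<noteq> k" "i < N" for i using that k inj by auto
    then show ?thesis
      using k by (intro eq_matI) (auto simp: mat_delete_def grounded_laplacian_def)
  qed
  ultimately show ?thesis by simp
qed

text \<open>The same recurrence for edge sets: those that avoid \<open>{u, r}\<close>, and those that contain it.\<close>

lemma card_spanning_forests_crossing:
  assumes F: "finite V" "finite F" and ur: "u \<in> V - R" "r \<in> R" "{u, r} \<in> F"
  shows "card {T. T \<subseteq> F \<and> spans V T R \<and> card T = card (V - R)} =
    card {T. T \<subseteq> F - {{u, r}} \<and> spans V T R \<and> card T = card (V - R)} +
    card {T. T \<subseteq> F - {{u, r}} \<and> spans V T (insert u R) \<and> card T = card (V - insert u R)}"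
    (is "card ?X = card ?Y + card ?Z")
proof -
  let ?e = "{u, r}"
  have k: "card (V - R) = Suc (card (V - insert u R))"
    using F(1) ur(1) by (metis Diff_insert card_Suc_Diff1 finite_Diff)
  have fin: "finite T" if "T \<subseteq> F" for T using F(2) that finite_subset by blast
  have "?X = ?Y \<union> insert ?e ` ?Z"
  proof (intro equalityI subsetI)
    fix T assume T: "T \<in> ?X"
    show "T \<in> ?Y \<union> insert ?e ` ?Z"
    proof (cases "?e \<in> T")
      case True
      then have T': "T = insert ?e (T - {?e})" by blast
      have "T - {?e} \<in> ?Z"
        using T True k fin spans_remove_crossing_edge[OF ur(2), of V u "T - {?e}"]
        by (auto simp: insert_absorb)
      then show ?thesis using T' by blast
    qed (use T in auto)
  next
    fix T assume "T \<in> ?Y \<union> insert ?e ` ?Z"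
    then show "T \<in> ?X"
    proof
      assume "T \<in> insert ?e ` ?Z"
      then obtain S where S: "S \<in> ?Z" "T = insert ?e S" by blast
      then have "finite S" "?e \<notin> S" using fin by auto
      then show ?thesis
        using S k ur(3) by (simp add: spans_remove_crossing_edge[OF ur(2)]) blast
    qed auto
  qed
  moreover have "?Y \<inter> insert ?e ` ?Z = {}" by auto
  moreover have "inj_on (insert ?e) ?Z" by (auto simp: inj_on_def)
  moreover have "finite ?Y" "finite ?Z"
    using F(2) by (auto intro: finite_subset[of _ "Pow F"])
  ultimately show ?thesis by (simp add: card_Un_disjoint card_image)
qed

text \<open>Both sides satisfy the same
  recurrence for an edge that crosses from \<open>R\<close> to its complement, and they agree where no such edge is
  left: there both vanish, unless every vertex is a root and both are 1.\<close>

theorem det_grounded_laplacian: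
  assumes v: "bij_betw v {..<N} V" and "R \<subseteq> V" and "\<forall>e\<in>F. e \<subseteq> V \<and> card e = 2"
  shows "det (grounded_laplacian N v F R) =
    real (card {T. T \<subseteq> F \<and> spans V T R \<and> card T = card (V - R)})"
proof -
  have V: "finite V" using v bij_betw_finite by blast
  then have "finite F" using assms(3) by (meson PowI finite_Pow_iff rev_finite_subset subsetI)
  then show ?thesis
    using assms(2,3)
  proof (induction "card F" arbitrary: F R rule: less_induct)
    case less
    note F = less.prems
    show ?case
    proof (cases "\<exists>u\<in>V - R. \<exists>r\<in>R. {u, r} \<in> F")
      case True
      then obtain u r where ur: "u \<in> V - R" "r \<in> R" "{u, r} \<in> F" by blast
      have "card (F - {{u, r}}) < card F" by (rule card_Diff1_less[OF F(1) ur(3)])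
      note IH = less.hyps[OF this]
      show ?thesis
        unfolding det_grounded_laplacian_crossing[OF v V F(3) ur]
          card_spanning_forests_crossing[OF V F(1) ur]
        using F ur by (subst (1 2) IH) auto
    next
      case nc: False
      show ?thesis
      proof (cases "R = V")
        case True
        have "v i \<in> R" if "i < N" for i using True v that by (auto simp: bij_betw_def)
        then have "grounded_laplacian N v F R = 1\<^sub>m N"
          by (intro eq_matI) (auto simp: grounded_laplacian_def)
        moreover have "{T. T \<subseteq> F \<and> spans V T R \<and> card T = card (V - R)} = {{}}"
          using True F(1) finite_subset[OF _ F(1)] by (auto simp: spans_def)
        ultimately show ?thesis by simp
      next
        case False
        then have R: "R \<subset> V" using F by blast
        have "\<not> spans V T R" if "T \<subseteq> F" for T
        proof
          assume "spans V T R"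
          moreover have "\<forall>e\<in>T. e \<subseteq> V" using F(3) that by blast
          ultimately obtain u r where "u \<in> V - R" "r \<in> R" "{u, r} \<in> T"
            using spans_crossing_edge[OF _ R] by metis
          then show False using nc that by blast
        qed
        then have "{T. T \<subseteq> F \<and> spans V T R \<and> card T = card (V - R)} = {}" by blast
        moreover have "det (grounded_laplacian N v F R) = 0"
          using det_grounded_laplacian_no_crossing[OF v R F(3)] nc by blast
        ultimately show ?thesis by (metis card.empty of_nat_0)
      qed
    qed
  qed
qed

definition laplacian :: "nat \<Rightarrow> (nat \<Rightarrow> 'a) \<Rightarrow> 'a set set \<Rightarrow> real mat" where
  "laplacian N v E = grounded_laplacian N v E {}"

theorem matrix_tree:
  assumes G: "simple_graph (V, E)" and v: "bij_betw v {..<N} V" and k: "k < N"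
  shows "det (mat_delete (laplacian N v E) k k) = real (num_spanning_trees (V, E))"
proof -
  have vk: "v k \<in> V" using v k by (auto simp: bij_betw_def)
  have inj: "v i \<noteq> v k" if "i < N" "i \<noteq> k" for i
    using v that k by (auto simp: bij_betw_def inj_on_def)
  let ?M = "grounded_laplacian N v E {v k}"
  have "mat_delete (laplacian N v E) k k = mat_delete ?M k k"
    using k inj by (intro eq_matI) (auto simp: mat_delete_def laplacian_def grounded_laplacian_def)
  also have "det \<dots> = det ?M"
    by (rule det_unit_row[OF grounded_laplacian_carrier k, symmetric])
      (use k in \<open>auto simp: grounded_laplacian_def\<close>)
  also have "\<dots> = real (num_spanning_trees (V, E))"
    using det_grounded_laplacian[OF v, of "{v k}" E] G vk
    by (simp add: num_spanning_trees_eq_card_spans[OF G vk] simple_graph_def)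
  finally show ?thesis .
qed

lemma char_poly_coeff_0:
  fixes A :: "real mat"
  assumes A: "A \<in> carrier_mat n n"
  shows "coeff (char_poly A) 0 = (-1) ^ n * det A"
proof -
  have "poly (char_poly A) 0 = det (- 1 \<cdot>\<^sub>m A)"
    unfolding char_poly_def
    by (rule poly_det_cong[of _ n]) (use A in \<open>auto simp: char_poly_matrix_def\<close>)
  then show ?thesis
    using A by (simp add: poly_0_coeff_0)
qed

text \<open>The derivative of the characteristic polynomial is the sum of those of the principal submatrices of
  size \<open>N - 1\<close>, and by the matrix tree theorem each of the \<open>N\<close> minors counts the spanning trees.\<close>

lemma char_poly_laplacian_coeff_1:
  assumes G: "simple_graph (V, E)" and v: "bij_betw v {..<N} V"
  shows "coeff (char_poly (laplacian N v E)) 1 =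
    (-1) ^ (N - 1) * real N * real (num_spanning_trees (V, E))"
proof -
  let ?L = "laplacian N v E"
  have L: "?L \<in> carrier_mat N N" by (simp add: laplacian_def grounded_laplacian_carrier)
  have "coeff (char_poly ?L) 1 = coeff (pderiv (char_poly ?L)) 0"
    by (simp add: coeff_pderiv)
  also have "\<dots> = (\<Sum>i<N. coeff (char_poly (mat_delete ?L i i)) 0)"
    by (simp add: pderiv_char_poly[OF L] coeff_sum)
  also have "\<dots> = (\<Sum>i<N. (-1) ^ (N - 1) * real (num_spanning_trees (V, E)))"
    by (intro sum.cong refl)
      (simp add: char_poly_coeff_0[OF mat_delete_carrier[OF L]] matrix_tree[OF G v])
  finally show ?thesis by simp
qed

section \<open>Determinants of cyclic tridiagonal matrices\<close>

fun continuant :: "(nat \<Rightarrow> 'a) \<Rightarrow> nat \<Rightarrow> 'a :: comm_ring_1" where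
  "continuant a 0 = 1"
| "continuant a (Suc 0) = a 0"
| "continuant a (Suc (Suc m)) = a (Suc m) * continuant a (Suc m) - continuant a m"

definition tridiag :: "(nat \<Rightarrow> 'a :: comm_ring_1) \<Rightarrow> nat \<Rightarrow> 'a mat" where
  "tridiag a m = mat m m (\<lambda>(i, j). if i = j then a i else if j = Suc i \<or> i = Suc j then -1 else 0)"

definition cyclic_tridiag :: "(nat \<Rightarrow> 'a :: comm_ring_1) \<Rightarrow> 'a \<Rightarrow> nat \<Rightarrow> 'a mat" where
  "cyclic_tridiag a c m = mat m m (\<lambda>(i, j). if i = j then a i else if j = Suc i \<or> i = Suc j then -1
     else if (i = 0 \<and> j = m - 1) \<or> (i = m - 1 \<and> j = 0) then c else 0)"

lemma prod_list_diag_mat: "prod_list (diag_mat A) = (\<Prod>i<dim_row A. A $$ (i, i))"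
  by (simp add: diag_mat_def prod.list_conv_set_nth atLeast0LessThan)

lemma sum_support:
  assumes "finite S" "T \<subseteq> S" "\<And>i. i \<in> S - T \<Longrightarrow> f i = 0"
  shows "sum f S = sum f T"
  using assms by (intro sum.mono_neutral_right) auto

lemma det_tridiag: "det (tridiag a m) = continuant a m"
proof (induction a m rule: continuant.induct)
  case (2 a)
  show ?case using det_single[of "tridiag a (Suc 0)"] by (simp add: tridiag_def)
next
  case (3 a m)
  let ?A = "tridiag a (Suc (Suc m))"
  let ?D = "mat_delete ?A (Suc m) m"
  have A: "?A \<in> carrier_mat (Suc (Suc m)) (Suc (Suc m))" by (simp add: tridiag_def)
  have D: "?D \<in> carrier_mat (Suc m) (Suc m)" by (simp add: tridiag_def mat_delete_def)
  have "mat_delete ?D m m = tridiag a m"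
    by (intro eq_matI) (auto simp: mat_delete_def tridiag_def)
  then have "det ?D = - continuant a m"
    unfolding laplace_expansion_column[OF D lessI]
    by (subst sum_support[of _ "{m}"]) (auto simp: cofactor_def mat_delete_def tridiag_def 3[unfolded tridiag_def])
  moreover have "mat_delete ?A (Suc m) (Suc m) = tridiag a (Suc m)"
    by (intro eq_matI) (auto simp: mat_delete_def tridiag_def)
  moreover have "det ?A = (\<Sum>j\<in>{m, Suc m}. ?A $$ (Suc m, j) * cofactor ?A (Suc m) j)"
    unfolding laplace_expansion_row[OF A lessI]
    by (rule sum_support) (auto simp: tridiag_def)
  ultimately show ?case
    by (simp add: cofactor_def 3) (simp add: tridiag_def)
qed (simp add: tridiag_def)

text \<open>Expanding twice, along the last row and then along the last column, leaves only tridiagonal minors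
  and triangular minors with diagonal entries \<open>-1\<close>. The two permutations that run once around the
  cycle are the source of the term \<open>2 * c\<close>.\<close>

lemma det_cyclic_tridiag:
  assumes p: "p > 0"
  shows "det (cyclic_tridiag a c (Suc (Suc p))) =
    continuant a (Suc (Suc p)) - c\<^sup>2 * continuant (a \<circ> Suc) p + 2 * c"
proof -
  let ?A = "cyclic_tridiag a c (Suc (Suc p))"
  let ?D = "mat_delete ?A (Suc p) p"
  let ?E = "mat_delete ?A (Suc p) 0"
  have A: "?A \<in> carrier_mat (Suc (Suc p)) (Suc (Suc p))" by (simp add: cyclic_tridiag_def)
  have D: "?D \<in> carrier_mat (Suc p) (Suc p)" and E: "?E \<in> carrier_mat (Suc p) (Suc p)"
    by (simp_all add: cyclic_tridiag_def mat_delete_def)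

  have "det (mat_delete ?D 0 p) = (-1) ^ p"
    by (subst det_upper_triangular[of _ p])
      (auto simp: prod_list_diag_mat mat_delete_def cyclic_tridiag_def)
  then have D0: "cofactor ?D 0 p = 1"
    by (simp add: cofactor_def flip: power_mult_distrib)
  have "mat_delete ?D p p = tridiag a p"
    by (intro eq_matI) (auto simp: mat_delete_def tridiag_def cyclic_tridiag_def)
  then have Dp: "cofactor ?D p p = continuant a p"
    by (simp add: cofactor_diag det_tridiag)
  have "det ?D = (\<Sum>i\<in>{0, p}. ?D $$ (i, p) * cofactor ?D i p)"
    unfolding laplace_expansion_column[OF D lessI]
    by (rule sum_support) (auto simp: mat_delete_def cyclic_tridiag_def)
  then have detD: "det ?D = c - continuant a p"
    using p by (simp add: D0 Dp) (simp add: mat_delete_def cyclic_tridiag_def)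

  have "mat_delete ?E 0 p = tridiag (a \<circ> Suc) p"
    by (intro eq_matI) (auto simp: mat_delete_def tridiag_def cyclic_tridiag_def)
  then have E0: "cofactor ?E 0 p = (-1) ^ p * continuant (a \<circ> Suc) p"
    by (simp add: cofactor_def det_tridiag)
  have "det (mat_delete ?E p p) = (-1) ^ p"
    by (subst det_lower_triangular[of p])
      (auto simp: prod_list_diag_mat mat_delete_def cyclic_tridiag_def)
  then have Ep: "cofactor ?E p p = (-1) ^ p"
    by (simp add: cofactor_diag)
  have "det ?E = (\<Sum>i\<in>{0, p}. ?E $$ (i, p) * cofactor ?E i p)"
    unfolding laplace_expansion_column[OF E lessI]
    by (rule sum_support) (auto simp: mat_delete_def cyclic_tridiag_def)
  then have detE: "det ?E = (-1) ^ p * (c * continuant (a \<circ> Suc) p - 1)"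
    using p by (simp add: E0 Ep) (simp add: mat_delete_def cyclic_tridiag_def algebra_simps)

  have last: "mat_delete ?A (Suc p) (Suc p) = tridiag a (Suc p)"
    by (intro eq_matI) (auto simp: mat_delete_def tridiag_def cyclic_tridiag_def)
  have cof: "cofactor ?A (Suc p) (Suc p) = continuant a (Suc p)"
    "cofactor ?A (Suc p) p = continuant a p - c"
    "cofactor ?A (Suc p) 0 = 1 - c * continuant (a \<circ> Suc) p"
    by (simp_all add: cofactor_diag last det_tridiag)
      (simp_all add: cofactor_def detD detE flip: mult.assoc power_mult_distrib)
  have "det ?A = (\<Sum>j\<in>{0, p, Suc p}. ?A $$ (Suc p, j) * cofactor ?A (Suc p) j)"
    unfolding laplace_expansion_row[OF A lessI]
    by (rule sum_support) (auto simp: cyclic_tridiag_def)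
  also have "\<dots> = c * cofactor ?A (Suc p) 0 - cofactor ?A (Suc p) p + a (Suc p) * cofactor ?A (Suc p) (Suc p)"
    using p by (simp add: cyclic_tridiag_def)
  finally show ?thesis
    by (simp add: cof algebra_simps power2_eq_square)
qed

text \<open>The Vieta--Lucas polynomials, with \<open>V\<^sub>k(s + 1/s) = s\<^sup>k + 1/s\<^sup>k\<close>: the trace of the \<open>k\<close>-th power of
  a \<open>2 \<times> 2\<close> matrix with trace \<open>u\<close> and determinant 1.\<close>

fun vieta_lucas :: "nat \<Rightarrow> 'a \<Rightarrow> 'a :: comm_ring_1" where
  "vieta_lucas 0 u = 2"
| "vieta_lucas (Suc 0) u = u"
| "vieta_lucas (Suc (Suc k)) u = u * vieta_lucas (Suc k) u - vieta_lucas k u"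

text \<open>Indices start at 0, so \<open>a\<close> stands at the positions that are odd when counted from 1.\<close>

definition alternating :: "'a \<Rightarrow> 'a \<Rightarrow> nat \<Rightarrow> 'a" where
  "alternating a b i = (if even i then a else b)"

text \<open>Two steps of the continuant recurrence multiply by a transfer matrix of determinant 1 and trace
  \<open>a * b - 2\<close>; this is its Cayley--Hamilton relation.\<close>

lemma continuant_alternating_rec:
  "continuant (alternating a b) (2 * Suc (Suc k)) =
    (a * b - 2) * continuant (alternating a b) (2 * Suc k) - continuant (alternating a b) (2 * k)"
  by (simp add: alternating_def algebra_simps)

lemma continuant_alternating_swap:
  "continuant (alternating a b) (2 * k) = continuant (alternating b a) (2 * k)"
proof (induction k rule: induct_nat_012)
  case 1
  show ?case by (simp add: alternating_def numeral_2_eq_2 mult.commute)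
next
  case (ge2 k)
  then show ?case by (simp only: continuant_alternating_rec mult.commute[of b a])
qed simp

lemma continuant_alternating_diff:
  "continuant (alternating a b) (2 * Suc k) - continuant (alternating a b) (2 * k) =
    vieta_lucas (Suc k) (a * b - 2)"
proof (induction k rule: induct_nat_012)
  case 0
  show ?case by (simp add: alternating_def numeral_2_eq_2 algebra_simps)
next
  case 1
  show ?case
    unfolding One_nat_def continuant_alternating_rec
    by (simp add: alternating_def numeral_2_eq_2 algebra_simps)
next
  case (ge2 k)
  let ?c = "\<lambda>k. continuant (alternating a b) (2 * k)"
  have "?c (Suc (Suc (Suc k))) - ?c (Suc (Suc k)) =
      ((a * b - 2) * ?c (Suc (Suc k)) - ?c (Suc k)) - ((a * b - 2) * ?c (Suc k) - ?c k)"
    by (intro arg_cong2[of _ _ _ _ minus] continuant_alternating_rec)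
  also have "\<dots> = (a * b - 2) * (?c (Suc (Suc k)) - ?c (Suc k)) - (?c (Suc k) - ?c k)"
    by (simp only: algebra_simps)
  finally show ?case by (simp only: ge2.IH vieta_lucas.simps)
qed

theorem det_cyclic_alternating:
  assumes n: "n \<ge> 2" and c: "c\<^sup>2 = 1"
  shows "det (cyclic_tridiag (alternating a b) c (2 * n)) = vieta_lucas n (a * b - 2) + 2 * c"
proof -
  obtain k where k: "n = Suc k" "k > 0" using n by (cases n) auto
  have "alternating a b \<circ> Suc = alternating b a" by (auto simp: alternating_def)
  then have "det (cyclic_tridiag (alternating a b) c (2 * n)) =
      continuant (alternating a b) (2 * Suc k) - continuant (alternating b a) (2 * k) + 2 * c"
    using det_cyclic_tridiag[of "2 * k" "alternating a b" c] k c by simp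
  then show ?thesis
    using k continuant_alternating_diff[of a b k] continuant_alternating_swap[of a b k] by simp
qed

lemma poly_vieta_lucas: "poly (vieta_lucas k p) x = vieta_lucas k (poly p x)"
  by (induction k p rule: vieta_lucas.induct) simp_all

lemma vieta_lucas_2: "vieta_lucas k 2 = 2"
  by (induction k "2 :: 'a" rule: vieta_lucas.induct) simp_all

lemma vieta_lucas_power_sum:
  assumes "s * t = 1"
  shows "vieta_lucas k (s + t) = s ^ k + t ^ k"
proof (induction k rule: induct_nat_012)
  case (ge2 k)
  have "s * (t * t ^ k) = t ^ k" "t * (s * s ^ k) = s ^ k"
    using assms by (simp_all flip: mult.assoc add: mult.commute)
  then show ?case using ge2 by (simp add: algebra_simps)
qed simp_all

text \<open>This is used to see that \<open>vieta_lucas n u = 2\<close> has no solution \<open>u > 2\<close>, which excludes negative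
  eigenvalues without an argument about definiteness.\<close>

lemma vieta_lucas_increasing:
  fixes u :: "'a :: linordered_idom"
  assumes "u > 2"
  shows "vieta_lucas (Suc k) u > vieta_lucas k u \<and> vieta_lucas k u \<ge> 2"
proof (induction k)
  case (Suc k)
  then have "vieta_lucas (Suc k) u > 2" by simp
  then have "u * vieta_lucas (Suc k) u > 2 * vieta_lucas (Suc k) u" using assms by simp
  then have "vieta_lucas (Suc (Suc k)) u > 2 * vieta_lucas (Suc k) u - vieta_lucas k u" by simp
  then show ?case using Suc \<open>vieta_lucas (Suc k) u > 2\<close> by linarith
qed (use assms in simp)

text \<open>The value \<open>V\<^sub>k'(2) = k\<^sup>2\<close>, composed with a polynomial by the chain rule.\<close>

lemma pderiv_vieta_lucas_at_2:
  fixes p :: "'a :: idom poly"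
  assumes "poly p x = 2"
  shows "poly (pderiv (vieta_lucas k p)) x = of_nat (k\<^sup>2) * poly (pderiv p) x"
proof (induction k rule: induct_nat_012)
  case (ge2 k)
  then show ?case
    using assms by (simp add: pderiv_mult pderiv_diff poly_vieta_lucas vieta_lucas_2 algebra_simps power2_eq_square)
qed simp_all

section \<open>Block determinants\<close>

lemma poly_char_poly_eq_det:
  fixes A :: "'a :: comm_ring_1 mat"
  assumes A: "A \<in> carrier_mat n n"
  shows "poly (char_poly A) x = det (x \<cdot>\<^sub>m 1\<^sub>m n - A)"
  unfolding char_poly_def
  by (rule poly_det_cong[of _ n]) (use A in \<open>auto simp: char_poly_matrix_def\<close>)

lemma det_four_block_schur:
  fixes t :: "'a :: field"
  assumes t: "t \<noteq> 0" and B: "B \<in> carrier_mat n m" and C: "C \<in> carrier_mat m n"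
    and D: "D \<in> carrier_mat m m"
  shows "det (four_block_mat (t \<cdot>\<^sub>m 1\<^sub>m n) B C D) = t ^ n * det (D - (1 / t) \<cdot>\<^sub>m (C * B))"
proof -
  let ?M = "four_block_mat (t \<cdot>\<^sub>m 1\<^sub>m n) B C D"
  let ?P = "four_block_mat (1\<^sub>m n) ((- 1 / t) \<cdot>\<^sub>m B) (0\<^sub>m m n) (1\<^sub>m m)"
  have "?M * ?P = four_block_mat
      (t \<cdot>\<^sub>m 1\<^sub>m n * 1\<^sub>m n + B * 0\<^sub>m m n) (t \<cdot>\<^sub>m 1\<^sub>m n * ((- 1 / t) \<cdot>\<^sub>m B) + B * 1\<^sub>m m)
      (C * 1\<^sub>m n + D * 0\<^sub>m m n) (C * ((- 1 / t) \<cdot>\<^sub>m B) + D * 1\<^sub>m m)"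
    using B C D by (intro mult_four_block_mat) auto
  also have "\<dots> = four_block_mat (t \<cdot>\<^sub>m 1\<^sub>m n) (0\<^sub>m n m) C (D - (1 / t) \<cdot>\<^sub>m (C * B))"
  proof (rule cong_four_block_mat)
    have "t \<cdot>\<^sub>m 1\<^sub>m n * ((- 1 / t) \<cdot>\<^sub>m B) = t \<cdot>\<^sub>m (1\<^sub>m n * ((- 1 / t) \<cdot>\<^sub>m B))"
      using B by (intro mult_smult_assoc_mat) auto
    then show "t \<cdot>\<^sub>m 1\<^sub>m n * ((- 1 / t) \<cdot>\<^sub>m B) + B * 1\<^sub>m m = 0\<^sub>m n m"
      using B t by (intro eq_matI) auto
    have "C * ((- 1 / t) \<cdot>\<^sub>m B) = (- 1 / t) \<cdot>\<^sub>m (C * B)"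
      using B C by (intro mult_smult_distrib) auto
    then show "C * ((- 1 / t) \<cdot>\<^sub>m B) + D * 1\<^sub>m m = D - (1 / t) \<cdot>\<^sub>m (C * B)"
      using B C D by (intro eq_matI) auto
  qed (use B C D in auto)
  finally have "det (?M * ?P) = t ^ n * det (D - (1 / t) \<cdot>\<^sub>m (C * B))"
    using B C D by (simp add: det_four_block_mat_upper_right_zero[of _ n _ m] minus_carrier_mat)
  moreover have "det ?P = 1"
    using B by (simp add: det_four_block_mat_lower_left_zero[of _ n _ m])
  moreover have "?M \<in> carrier_mat (n + m) (n + m)" "?P \<in> carrier_mat (n + m) (n + m)"
    using D by (auto intro: four_block_carrier_mat)
  ultimately show ?thesis
    by (simp add: det_mult)
qed

text \<open>Adding the second block row to the first and then subtracting the first block column from the second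
  makes the matrix block triangular.\<close>

lemma det_four_block_symmetric:
  fixes R S :: "'a :: idom mat"
  assumes R: "R \<in> carrier_mat m m" and S: "S \<in> carrier_mat m m"
  shows "det (four_block_mat R S S R) = det (R + S) * det (R - S)"
proof -
  let ?M = "four_block_mat R S S R"
  let ?P = "four_block_mat (1\<^sub>m m) (1\<^sub>m m) (0\<^sub>m m m) (1\<^sub>m m) :: 'a mat"
  let ?Q = "four_block_mat (1\<^sub>m m) (- 1 \<cdot>\<^sub>m 1\<^sub>m m) (0\<^sub>m m m) (1\<^sub>m m) :: 'a mat"
  have "?P * ?M = four_block_mat (1\<^sub>m m * R + 1\<^sub>m m * S) (1\<^sub>m m * S + 1\<^sub>m m * R)
      (0\<^sub>m m m * R + 1\<^sub>m m * S) (0\<^sub>m m m * S + 1\<^sub>m m * R)"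
    using R S by (intro mult_four_block_mat) auto
  also have "\<dots> = four_block_mat (R + S) (R + S) S R"
    using R S by (intro cong_four_block_mat) (auto simp: comm_add_mat[of S m m R])
  finally have "?P * ?M * ?Q = four_block_mat
      ((R + S) * 1\<^sub>m m + (R + S) * 0\<^sub>m m m) ((R + S) * (- 1 \<cdot>\<^sub>m 1\<^sub>m m) + (R + S) * 1\<^sub>m m)
      (S * 1\<^sub>m m + R * 0\<^sub>m m m) (S * (- 1 \<cdot>\<^sub>m 1\<^sub>m m) + R * 1\<^sub>m m)"
    using R S by (simp only:) (intro mult_four_block_mat, auto)
  also have "\<dots> = four_block_mat (R + S) (0\<^sub>m m m) S (R - S)"
  proof (rule cong_four_block_mat)
    have "(R + S) * (- 1 \<cdot>\<^sub>m 1\<^sub>m m) = - 1 \<cdot>\<^sub>m ((R + S) * 1\<^sub>m m)"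
      using R S by (intro mult_smult_distrib) auto
    then show "(R + S) * (- 1 \<cdot>\<^sub>m 1\<^sub>m m) + (R + S) * 1\<^sub>m m = 0\<^sub>m m m"
      using R S by (intro eq_matI) auto
    have "S * (- 1 \<cdot>\<^sub>m 1\<^sub>m m) = - 1 \<cdot>\<^sub>m (S * 1\<^sub>m m)"
      using S by (intro mult_smult_distrib) auto
    then show "S * (- 1 \<cdot>\<^sub>m 1\<^sub>m m) + R * 1\<^sub>m m = R - S"
      using R S by (intro eq_matI) auto
  qed (use R S in auto)
  finally have "det (?P * ?M * ?Q) = det (R + S) * det (R - S)"
    using R S by (simp add: det_four_block_mat_upper_right_zero[of _ m _ m] minus_carrier_mat)
  moreover have "det ?P = 1" "det ?Q = 1"
    by (simp_all add: det_four_block_mat_lower_left_zero[of _ m _ m])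
  moreover have "?M \<in> carrier_mat (m + m) (m + m)" "?P \<in> carrier_mat (m + m) (m + m)"
    "?Q \<in> carrier_mat (m + m) (m + m)"
    using R by (auto intro: four_block_carrier_mat)
  ultimately show ?thesis
    by (simp add: det_mult[of _ "m + m"] mult_carrier_mat[of _ "m + m" "m + m"])
qed

section \<open>The spectra of \<open>LA\<close> and \<open>LS_corner\<close>\<close>

lemma poly_eqI_off_point:
  fixes p q :: "'a :: field_char_0 poly"
  assumes "\<And>x. x \<noteq> a \<Longrightarrow> poly p x = poly q x"
  shows "p = q"
proof -
  (* The linear factor makes the vanishing unconditional. *)
  have "poly ((p - q) * [:- a, 1:]) x = 0" for x
    using assms[of x] by (cases "x = a") (auto simp del: mult_pCons_right)
  then have "(p - q) * [:- a, 1:] = 0" using poly_all_0_iff_0 by blast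
  then show ?thesis by (simp del: mult_pCons_right)
qed

lemma LS_corner_eq_cyclic_tridiag:
  "LS_corner c n = cyclic_tridiag (alternating 4 3) c (2 * n)"
  by (rule eq_matI) (auto simp: LS_corner_def mat1_def cyclic_tridiag_def alternating_def)

lemma det_LS_corner:
  assumes "n \<ge> 2" "c\<^sup>2 = 1"
  shows "det (LS_corner c n) = vieta_lucas n 10 + 2 * c"
  using det_cyclic_alternating[OF assms, of 4 3] by (simp add: LS_corner_eq_cyclic_tridiag)

lemma N_mat_gram: "transpose_mat (N_mat n) * N_mat n = mat (2 * n) (2 * n) (\<lambda>(i, j). of_bool (i = j \<and> odd i))"
proof (rule eq_matI)
  fix i j
  assume "i < dim_row (mat (2 * n) (2 * n) (\<lambda>(i, j). of_bool (i = j \<and> odd i)) :: real mat)"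
    and "j < dim_col (mat (2 * n) (2 * n) (\<lambda>(i, j). of_bool (i = j \<and> odd i)) :: real mat)"
  then have ij: "i < 2 * n" "j < 2 * n" by auto
  then have "(transpose_mat (N_mat n) * N_mat n) $$ (i, j) =
      (\<Sum>k<n. of_bool (i = 2 * k + 1) * of_bool (j = 2 * k + 1))"
    by (auto simp: N_mat_def mat1_def scalar_prod_def atLeast0LessThan simp del: sum_of_bool_mult_eq
        sum_mult_of_bool_eq intro!: sum.cong)
  also have "\<dots> = of_bool (i = j \<and> odd i)"
  proof (cases "i = j \<and> odd i")
    case True
    then obtain l where "i = 2 * l + 1" by (auto elim: oddE)
    then have "(\<Sum>k<n. of_bool (i = 2 * k + 1) * of_bool (j = 2 * k + 1) :: real) = (\<Sum>k<n. if k = l then 1 else 0)"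
      using True by (intro sum.cong) auto
    also have "\<dots> = 1" using \<open>i = 2 * l + 1\<close> ij by simp
    finally show ?thesis using True by auto
  next
    case False
    then have "(\<Sum>k<n. of_bool (i = 2 * k + 1) * of_bool (j = 2 * k + 1) :: real) = 0"
      by (intro sum.neutral) auto
    then show ?thesis using False by simp
  qed
  finally show "(transpose_mat (N_mat n) * N_mat n) $$ (i, j) =
      mat (2 * n) (2 * n) (\<lambda>(i, j). of_bool (i = j \<and> odd i)) $$ (i, j)"
    using ij by simp
qed (auto simp: N_mat_def mat1_def)

lemma N_mat_carrier: "N_mat n \<in> carrier_mat n (2 * n)"
  by (simp add: N_mat_def mat1_def)

text \<open>The Schur complement of the block of the tilde vertices in \<open>x - LA n\<close>. As \<open>N\<^sup>T N\<close> is diagonal, it is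
  still cyclic tridiagonal, up to sign.\<close>

definition schur_core :: "real \<Rightarrow> nat \<Rightarrow> real mat" where
  "schur_core x n = x \<cdot>\<^sub>m 1\<^sub>m (2 * n) - C_mat n - (2 / (x - 2)) \<cdot>\<^sub>m (transpose_mat (N_mat n) * N_mat n)"

lemma det_schur_core:
  assumes n: "n \<ge> 2" and x: "x \<noteq> 2"
  shows "det (schur_core x n) = vieta_lucas n (x\<^sup>2 - 5 * x + 2) - 2"
proof -
  let ?b = "3 - x + 2 / (x - 2)"
  let ?K = "cyclic_tridiag (alternating (2 - x) ?b) (- 1) (2 * n)"
  have K: "?K \<in> carrier_mat (2 * n) (2 * n)" by (simp add: cyclic_tridiag_def)
  have "schur_core x n = - 1 \<cdot>\<^sub>m ?K"
    unfolding schur_core_def N_mat_gram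
    using n by (intro eq_matI)
      (auto simp: C_mat_def mat1_def cyclic_tridiag_def alternating_def algebra_simps)
  then have "det (schur_core x n) = det ?K"
    using K by simp
  also have "\<dots> = vieta_lucas n ((2 - x) * ?b - 2) - 2"
    using det_cyclic_alternating[OF n, of "- 1" "2 - x" ?b] by simp
  also have "(2 - x) * ?b - 2 = x\<^sup>2 - 5 * x + 2"
    using x by (simp add: field_simps power2_eq_square)
  finally show ?thesis .
qed

lemma poly_char_poly_LA:
  assumes x: "x \<noteq> 2"
  shows "poly (char_poly (LA n)) x = (x - 2) ^ n * det (schur_core x n)"
proof -
  let ?B = "(- sqrt 2) \<cdot>\<^sub>m N_mat n"
  let ?C = "(- sqrt 2) \<cdot>\<^sub>m transpose_mat (N_mat n)"
  have "x \<cdot>\<^sub>m 1\<^sub>m (3 * n) - LA n =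
      four_block_mat ((x - 2) \<cdot>\<^sub>m 1\<^sub>m n) ?B ?C (x \<cdot>\<^sub>m 1\<^sub>m (2 * n) - C_mat n)"
    by (rule eq_matI) (auto simp: LA_def N_mat_def C_mat_def mat1_def algebra_simps)
  then have "poly (char_poly (LA n)) x =
      (x - 2) ^ n * det (x \<cdot>\<^sub>m 1\<^sub>m (2 * n) - C_mat n - (1 / (x - 2)) \<cdot>\<^sub>m (?C * ?B))"
    using x N_mat_carrier[of n] C_mat_carrier[of n]
      det_four_block_schur[of "x - 2" ?B n "2 * n" ?C "x \<cdot>\<^sub>m 1\<^sub>m (2 * n) - C_mat n"]
    by (simp add: poly_char_poly_eq_det[OF LA_carrier] minus_carrier_mat)
  moreover have "?C * ?B = 2 \<cdot>\<^sub>m (transpose_mat (N_mat n) * N_mat n)"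
  proof -
    have "?C * ?B = (- sqrt 2) \<cdot>\<^sub>m (transpose_mat (N_mat n) * ?B)"
      using N_mat_carrier[of n] by (intro mult_smult_assoc_mat) auto
    also have "transpose_mat (N_mat n) * ?B = (- sqrt 2) \<cdot>\<^sub>m (transpose_mat (N_mat n) * N_mat n)"
      using N_mat_carrier[of n] by (intro mult_smult_distrib) auto
    finally show ?thesis by (intro eq_matI) (auto simp flip: mult.assoc)
  qed
  ultimately show ?thesis
    by (simp add: schur_core_def) (auto intro!: arg_cong[of _ _ det] eq_matI)
qed

lemma char_poly_LA:
  assumes n: "n \<ge> 2"
  shows "char_poly (LA n) = [:-2, 1:] ^ n * (vieta_lucas n [:2, -5, 1:] - 2)"
proof (rule poly_eqI_off_point[of 2])
  fix x :: real assume "x \<noteq> 2"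
  then show "poly (char_poly (LA n)) x = poly ([:-2, 1:] ^ n * (vieta_lucas n [:2, -5, 1:] - 2)) x"
    by (simp add: poly_char_poly_LA det_schur_core[OF n] poly_vieta_lucas algebra_simps power2_eq_square)
qed

lemma char_poly_LA_root_0:
  assumes n: "n \<ge> 2"
  shows "poly (char_poly (LA n)) 0 = 0"
  by (simp add: char_poly_LA[OF n] poly_vieta_lucas vieta_lucas_2)

lemma char_poly_LA_roots_nonneg:
  assumes n: "n \<ge> 2" and root: "poly (char_poly (LA n)) x = 0"
  shows "x \<ge> 0"
proof (rule ccontr)
  assume "\<not> x \<ge> 0"
  then have x: "x < 0" by simp
  then have "x * (x - 5) > 0" by (intro mult_neg_neg) auto
  then have u: "2 + x * (x - 5) > 2" by simp
  obtain k where k: "n = Suc k" using n by (cases n) auto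
  have "vieta_lucas n (2 + x * (x - 5)) > 2"
    using vieta_lucas_increasing[OF u, of k] k by simp
  then show False
    using root x by (simp add: char_poly_LA[OF n] poly_vieta_lucas)
qed

text \<open>The factor \<open>vieta_lucas n [:2, -5, 1:] - 2\<close> vanishes at 0, so only its derivative contributes, which
  is \<open>n\<^sup>2 * (-5)\<close>.\<close>

lemma char_poly_LA_coeff_1:
  assumes n: "n \<ge> 2"
  shows "coeff (char_poly (LA n)) 1 = (-1) ^ (3 * n - 1) * (5 * (real n)\<^sup>2 * 2 ^ n)"
proof -
  have "coeff (char_poly (LA n)) 1 = poly (pderiv (char_poly (LA n))) 0"
    by (simp add: coeff_pderiv poly_0_coeff_0)
  also have "\<dots> = (- 2) ^ n * (real (n\<^sup>2) * (- 5))"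
    by (simp add: char_poly_LA[OF n] pderiv_mult pderiv_diff poly_vieta_lucas vieta_lucas_2
        pderiv_vieta_lucas_at_2 pderiv_pCons)
  also have "\<dots> = (-1) ^ (n + 1) * (5 * (real n)\<^sup>2 * 2 ^ n)"
    by (simp add: power_minus[of 2])
  also have "(-1 :: real) ^ (n + 1) = (-1) ^ (3 * n - 1)"
    using n by (auto simp: minus_one_power_iff)
  finally show ?thesis .
qed

lemma char_poly_eq_prod_eigenvalues:
  fixes A :: "real mat"
  assumes "A \<in> carrier_mat m m" and "transpose_mat A = A"
  shows "char_poly A = (\<Prod>a\<leftarrow>sorted_eigenvalues A. [:- a, 1:])"
proof -
  obtain as where as: "char_poly A = (\<Prod>a\<leftarrow>as. [:- a, 1:])"
    using symmetric_char_poly_splits[OF assms] by metis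
  have "proots (\<Prod>a\<leftarrow>as. [:- a, 1:]) = mset as"
  proof (induction as)
    case (Cons b bs)
    have "(\<Prod>a\<leftarrow>bs. [:- a, 1:]) \<noteq> 0"
      by (auto simp: prod_list_zero_iff)
    then show ?case
      using Cons.IH by (simp add: proots_mult del: mult_pCons_left)
  qed simp
  then have "mset (sorted_eigenvalues A) = mset as"
    by (simp add: sorted_eigenvalues_def as)
  then have "mset (map (\<lambda>a. [:- a, 1:]) (sorted_eigenvalues A)) = mset (map (\<lambda>a. [:- a, 1:]) as)"
    by simp
  then show ?thesis
    unfolding as by (metis prod_mset_prod_list)
qed

lemma coeff_0_prod_linear:
  "coeff (\<Prod>a\<leftarrow>as. [:- a, 1:]) 0 = (-1) ^ length as * prod_list (as :: real list)"
  by (induction as) (simp_all add: coeff_mult_0)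

lemma prod_eigval:
  fixes A :: "real mat"
  assumes A: "A \<in> carrier_mat m m" "transpose_mat A = A"
  shows "(\<Prod>j=1..m. eigval A j) = det A"
proof -
  let ?es = "sorted_eigenvalues A"
  have len: "length ?es = m" by (rule length_sorted_eigenvalues[OF A])
  have "(-1) ^ m * det A = (-1) ^ m * prod_list ?es"
    using char_poly_coeff_0[OF A(1)] len
    by (simp add: char_poly_eq_prod_eigenvalues[OF A] coeff_0_prod_linear)
  moreover have "(\<Prod>j=1..m. eigval A j) = prod_list ?es"
    unfolding prod.list_conv_set_nth len
    by (rule prod.reindex_bij_witness[of _ Suc "\<lambda>j. j - 1"]) (auto simp: eigval_def)
  ultimately show ?thesis by simp
qed

text \<open>If all roots are nonnegative and 0 is one of them, then the least eigenvalue is 0. Splitting off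
  the factor \<open>x\<close> leaves a polynomial whose constant term is, up to sign, the product of the others.\<close>

lemma prod_eigval_from_2:
  fixes A :: "real mat"
  assumes A: "A \<in> carrier_mat m m" "transpose_mat A = A"
    and root: "poly (char_poly A) 0 = 0"
    and nonneg: "\<And>x. poly (char_poly A) x = 0 \<Longrightarrow> x \<ge> 0"
  shows "(\<Prod>i=2..m. eigval A i) = (-1) ^ (m - 1) * coeff (char_poly A) 1"
proof -
  let ?es = "sorted_eigenvalues A"
  have len: "length ?es = m" by (rule length_sorted_eigenvalues[OF A])
  have roots: "poly (char_poly A) x = 0 \<longleftrightarrow> x \<in> set ?es" for x
    unfolding char_poly_eq_prod_eigenvalues[OF A] poly_prod_list
    by (auto simp: prod_list_zero_iff)
  have sorted: "sorted ?es" by (simp add: sorted_eigenvalues_def)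
  obtain e fs where es: "?es = e # fs" using root roots[of 0] by (cases ?es) auto
  have "e = 0"
    using root nonneg roots[of 0] roots[of e] sorted by (auto simp: es intro: antisym)
  then have "coeff (char_poly A) 1 = (-1) ^ (m - 1) * prod_list fs"
    using len by (auto simp: char_poly_eq_prod_eigenvalues[OF A] es coeff_0_prod_linear)
  moreover have "(\<Prod>i=2..m. eigval A i) = prod_list fs"
  proof -
    have "length fs = m - 1" using len es by auto
    then show ?thesis
      unfolding prod.list_conv_set_nth
      by (intro prod.reindex_bij_witness[of _ "\<lambda>i. i + 2" "\<lambda>j. j - 2"])
        (auto simp: eigval_def es nth_Cons' numeral_2_eq_2)
  qed
  ultimately show ?thesis
    by (simp flip: mult.assoc power_mult_distrib)
qed

section \<open>The Laplacian of the two pentagonal chains\<close>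

text \<open>Both graphs in one family: the sign of the corner entries of the antisymmetric block is the only
  trace that the twist leaves in the spectrum.\<close>

definition pent_graph :: "bool \<Rightarrow> nat \<Rightarrow> pvertex sgraph" where
  "pent_graph twist n = (pent_vertices n, pent_common_edges n \<union>
     (if twist then {{Plain (2*n), Prime 1}, {Prime (2*n), Plain 1}}
      else {{Plain (2*n), Plain 1}, {Prime (2*n), Prime 1}}))"

lemma pent_cylinder_eq: "pent_cylinder n = pent_graph False n"
  and pent_moebius_eq: "pent_moebius n = pent_graph True n"
  by (simp_all add: pent_cylinder_def pent_moebius_def pent_graph_def)

abbreviation pent_edges :: "bool \<Rightarrow> nat \<Rightarrow> pvertex set set" where
  "pent_edges twist n \<equiv> edges (pent_graph twist n)"

lemma pent_common_edges_rung_iff: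
  "{Plain i, Prime j} \<in> pent_common_edges n \<longleftrightarrow> i \<in> {1..2*n} \<and> i = j \<and> odd i"
  (is "?l \<longleftrightarrow> ?r")
proof
  assume ?l
  then obtain k where k: "i = 2 * k - 1" "j = 2 * k - 1" "k \<ge> 1" "k \<le> n"
    by (auto simp: pent_common_edges_def doubleton_eq_iff)
  then obtain l where "k = Suc l" by (cases k) auto
  then show ?r using k by simp
next
  assume r: ?r
  then obtain l where "i = 2 * Suc l - 1" "Suc l \<le> n" by (auto elim: oddE)
  then have "{Plain i, Prime j} = {Plain (2 * Suc l - 1), Prime (2 * Suc l - 1)}" "Suc l \<in> {1..n}"
    using r by auto
  then show ?l
    unfolding pent_common_edges_def by blast
qed

lemma pent_common_edges_iff:
  "{Tilde k, Tilde l} \<in> pent_common_edges n \<longleftrightarrow> False"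
  "{Tilde k, Plain i} \<in> pent_common_edges n \<longleftrightarrow> k \<in> {1..n} \<and> i = 2 * k"
  "{Tilde k, Prime i} \<in> pent_common_edges n \<longleftrightarrow> k \<in> {1..n} \<and> i = 2 * k"
  "{Plain i, Plain j} \<in> pent_common_edges n \<longleftrightarrow>
     i \<in> {1..2*n} \<and> j \<in> {1..2*n} \<and> (j = Suc i \<or> i = Suc j)"
  "{Prime i, Prime j} \<in> pent_common_edges n \<longleftrightarrow>
     i \<in> {1..2*n} \<and> j \<in> {1..2*n} \<and> (j = Suc i \<or> i = Suc j)"
  by (auto simp: pent_common_edges_def doubleton_eq_iff)

lemma pent_edges_iff:
  "{Tilde k, Tilde l} \<in> pent_edges twist n \<longleftrightarrow> False"
  "{Tilde k, Plain i} \<in> pent_edges twist n \<longleftrightarrow> k \<in> {1..n} \<and> i = 2 * k"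
  "{Tilde k, Prime i} \<in> pent_edges twist n \<longleftrightarrow> k \<in> {1..n} \<and> i = 2 * k"
  "{Plain i, Plain j} \<in> pent_edges twist n \<longleftrightarrow>
     i \<in> {1..2*n} \<and> j \<in> {1..2*n} \<and> (j = Suc i \<or> i = Suc j) \<or>
     \<not> twist \<and> (i = 1 \<and> j = 2 * n \<or> i = 2 * n \<and> j = 1)"
  "{Prime i, Prime j} \<in> pent_edges twist n \<longleftrightarrow>
     i \<in> {1..2*n} \<and> j \<in> {1..2*n} \<and> (j = Suc i \<or> i = Suc j) \<or>
     \<not> twist \<and> (i = 1 \<and> j = 2 * n \<or> i = 2 * n \<and> j = 1)"
  "{Plain i, Prime j} \<in> pent_edges twist n \<longleftrightarrow> i \<in> {1..2*n} \<and> i = j \<and> odd i \<or>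
     twist \<and> (i = 1 \<and> j = 2 * n \<or> i = 2 * n \<and> j = 1)"
  by (cases twist; simp add: pent_graph_def pent_common_edges_iff pent_common_edges_rung_iff doubleton_eq_iff; blast?)+

lemma pent_edges_iff_sym:
  "{Plain i, Tilde k} \<in> pent_edges twist n \<longleftrightarrow> k \<in> {1..n} \<and> i = 2 * k"
  "{Prime i, Tilde k} \<in> pent_edges twist n \<longleftrightarrow> k \<in> {1..n} \<and> i = 2 * k"
  "{Prime j, Plain i} \<in> pent_edges twist n \<longleftrightarrow> i \<in> {1..2*n} \<and> i = j \<and> odd i \<or>
     twist \<and> (i = 1 \<and> j = 2 * n \<or> i = 2 * n \<and> j = 1)"
  by (subst insert_commute, simp only: pent_edges_iff)+

lemma simple_graph_pent: "n \<ge> 1 \<Longrightarrow> simple_graph (pent_graph twist n)"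
  unfolding simple_graph_def
proof
  show "finite (vertices (pent_graph twist n))"
    by (simp add: pent_graph_def pent_vertices_def)
  assume "n \<ge> 1"
  then show "\<forall>e\<in>pent_edges twist n. e \<subseteq> vertices (pent_graph twist n) \<and> card e = 2"
    unfolding pent_graph_def pent_common_edges_def pent_vertices_def
    by (auto simp: card_2_iff' image_iff split: if_splits)
qed

lemma card_neighbours_Tilde:
  assumes "k \<in> {1..n}"
  shows "card {w. {Tilde k, w} \<in> pent_edges twist n} = 2"
proof -
  have "w \<in> {w. {Tilde k, w} \<in> pent_edges twist n} \<longleftrightarrow> w \<in> {Plain (2 * k), Prime (2 * k)}" for w
    using assms by (cases w) (auto simp: pent_edges_iff)
  then have "{w. {Tilde k, w} \<in> pent_edges twist n} = {Plain (2 * k), Prime (2 * k)}" by blast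
  then show ?thesis by simp
qed

lemma card_neighbours_Plain:
  assumes n: "n \<ge> 2" and i: "i \<in> {1..2*n}"
  shows "card {w. {Plain i, w} \<in> pent_edges twist n} = 3"
proof -
  let ?right = "if i < 2 * n then Plain (i + 1) else if twist then Prime 1 else Plain 1"
  let ?left = "if 1 < i then Plain (i - 1) else if twist then Prime (2 * n) else Plain (2 * n)"
  let ?rung = "if odd i then Prime i else Tilde (i div 2)"
  have "w \<in> {w. {Plain i, w} \<in> pent_edges twist n} \<longleftrightarrow> w \<in> {?left, ?right, ?rung}" for w
    using n i by (cases w) (auto simp: pent_edges_iff pent_edges_iff_sym)
  then have "{w. {Plain i, w} \<in> pent_edges twist n} = {?left, ?right, ?rung}" by blast
  moreover have "?left \<noteq> ?right" "?left \<noteq> ?rung" "?right \<noteq> ?rung" using n i by auto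
  ultimately show ?thesis by simp
qed

lemma card_neighbours_Prime:
  assumes n: "n \<ge> 2" and i: "i \<in> {1..2*n}"
  shows "card {w. {Prime i, w} \<in> pent_edges twist n} = 3"
proof -
  let ?right = "if i < 2 * n then Prime (i + 1) else if twist then Plain 1 else Prime 1"
  let ?left = "if 1 < i then Prime (i - 1) else if twist then Plain (2 * n) else Prime (2 * n)"
  let ?rung = "if odd i then Plain i else Tilde (i div 2)"
  have "w \<in> {w. {Prime i, w} \<in> pent_edges twist n} \<longleftrightarrow> w \<in> {?left, ?right, ?rung}" for w
    using n i by (cases w) (auto simp: pent_edges_iff pent_edges_iff_sym)
  then have "{w. {Prime i, w} \<in> pent_edges twist n} = {?left, ?right, ?rung}" by blast
  moreover have "?left \<noteq> ?right" "?left \<noteq> ?rung" "?right \<noteq> ?rung" using n i by auto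
  ultimately show ?thesis by simp
qed

text \<open>The order of the vertices is tilde, plain, primed, so that the reflection that exchanges \<open>i\<close>
  and \<open>i'\<close> exchanges the last two blocks of the Laplacian.\<close>

definition pent_vertex :: "nat \<Rightarrow> nat \<Rightarrow> pvertex" where
  "pent_vertex n i = (if i < n then Tilde (i + 1) else if i < 3 * n then Plain (i - n + 1)
     else Prime (i - 3 * n + 1))"

lemma bij_betw_pent_vertex: "bij_betw (pent_vertex n) {..<5*n} (pent_vertices n)"
proof (rule bij_betw_byWitness[where f' =
      "\<lambda>w. case w of Tilde k \<Rightarrow> k - 1 | Plain i \<Rightarrow> n + i - 1 | Prime i \<Rightarrow> 3 * n + i - 1"])
qed (auto simp: pent_vertex_def pent_vertices_def image_iff)

text \<open>The sum of the rim block and the rung block is \<open>C_mat\<close>, the action on symmetric vectors, and their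
  difference is \<open>LS_corner\<close>, the action on antisymmetric ones. Defining the blocks from these two
  matrices covers the cylinder (\<open>c = -1\<close>) and the Moebius chain (\<open>c = 1\<close>) at once: in the latter, the
  corner entries of the rim block cancel and appear in the rung block.\<close>

definition rim_block :: "real \<Rightarrow> nat \<Rightarrow> real mat" where
  "rim_block c n = (1 / 2) \<cdot>\<^sub>m (C_mat n + LS_corner c n)"

definition rung_block :: "real \<Rightarrow> nat \<Rightarrow> real mat" where
  "rung_block c n = (1 / 2) \<cdot>\<^sub>m (C_mat n - LS_corner c n)"

text \<open>The matrix \<open>N\<close> written twice side by side: a tilde vertex has the same edges to the plain and to the
  primed side.\<close>

definition N_twice :: "nat \<Rightarrow> real mat" where
  "N_twice n = mat n (4 * n) (\<lambda>(k, j). N_mat n $$ (k, if j < 2 * n then j else j - 2 * n))"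

lemma rim_block_index:
  assumes "n \<ge> 2" "a < 2 * n" "b < 2 * n"
  shows "rim_block (if twist then 1 else -1) n $$ (a, b) = (if a = b then 3 else
    - of_bool (b = Suc a \<or> a = Suc b \<or>
      \<not> twist \<and> (a = 0 \<and> Suc b = 2 * n \<or> Suc a = 2 * n \<and> b = 0)))"
  using assms by (auto simp: rim_block_def C_mat_def LS_corner_def mat1_def)

lemma rung_block_index:
  assumes "n \<ge> 2" "a < 2 * n" "b < 2 * n"
  shows "rung_block (if twist then 1 else -1) n $$ (a, b) = - of_bool (a = b \<and> even a \<or>
      twist \<and> (a = 0 \<and> Suc b = 2 * n \<or> Suc a = 2 * n \<and> b = 0))"
  using assms by (auto simp: rung_block_def C_mat_def LS_corner_def mat1_def)

lemma pent_index_cases: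
  assumes "i < 5 * n"
  obtains (tilde) "i < n" "pent_vertex n i = Tilde (i + 1)"
    | (plain) a where "i = n + a" "a < 2 * n" "pent_vertex n i = Plain (a + 1)"
    | (prime) a where "i = 3 * n + a" "a < 2 * n" "pent_vertex n i = Prime (a + 1)"
proof -
  consider "i < n" | "n \<le> i" "i < 3 * n" | "3 * n \<le> i" by linarith
  then show thesis
  proof cases
    case 1
    then show thesis by (intro tilde) (auto simp: pent_vertex_def)
  next
    case 2
    then show thesis by (intro plain[of "i - n"]) (auto simp: pent_vertex_def)
  next
    case 3
    then show thesis using assms by (intro prime[of "i - 3 * n"]) (auto simp: pent_vertex_def)
  qed
qed

lemma laplacian_pent:
  fixes twist :: bool and c :: real
  assumes n: "n \<ge> 2"
  defines "c \<equiv> if twist then 1 else -1"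
  shows "laplacian (5 * n) (pent_vertex n) (pent_edges twist n) =
    four_block_mat (2 \<cdot>\<^sub>m 1\<^sub>m n) (N_twice n) (transpose_mat (N_twice n))
      (four_block_mat (rim_block c n) (rung_block c n) (rung_block c n) (rim_block c n))"
    (is "?L = ?R")
proof (rule eq_matI)
  have dims: "dim_row (rim_block c n) = 2 * n" "dim_col (rim_block c n) = 2 * n"
    by (auto simp: rim_block_def LS_corner_def mat1_def)
  fix i j assume "i < dim_row ?R" "j < dim_col ?R"
  then have ij: "i < 5 * n" "j < 5 * n"
    by (auto simp: dims)
  let ?E = "pent_edges twist n"
  have L: "?L $$ (i, j) = (if i = j then real (card {w. {pent_vertex n i, w} \<in> ?E})
      else - of_bool ({pent_vertex n i, pent_vertex n j} \<in> ?E))"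
    using ij by (simp add: laplacian_def grounded_laplacian_def)
  note blocks = dims rim_block_index[OF n, of _ _ twist, folded c_def]
    rung_block_index[OF n, of _ _ twist, folded c_def] N_twice_def N_mat_def mat1_def
    card_neighbours_Tilde card_neighbours_Plain[OF n] card_neighbours_Prime[OF n]
    pent_edges_iff pent_edges_iff_sym
  from ij(1) show "?L $$ (i, j) = ?R $$ (i, j)"
  proof (cases rule: pent_index_cases)
    case i: tilde
    show ?thesis
      unfolding L by (rule pent_index_cases[OF ij(2)]) (use i in \<open>auto simp: blocks\<close>)
  next
    case i: (plain a)
    show ?thesis
      unfolding L by (rule pent_index_cases[OF ij(2)]) (use i n in \<open>simp_all add: blocks\<close>)
  next
    case i: (prime a)
    show ?thesis
      unfolding L by (rule pent_index_cases[OF ij(2)]) (use i n in \<open>auto simp: blocks\<close>)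
  qed
qed (auto simp: laplacian_def grounded_laplacian_def rim_block_def LS_corner_def mat1_def)

lemma N_twice_gram:
  defines "G \<equiv> \<lambda>n. transpose_mat (N_mat n) * N_mat n"
  shows "transpose_mat (N_twice n) * N_twice n = four_block_mat (G n) (G n) (G n) (G n)"
  by (rule eq_matI) (auto simp: G_def N_twice_def N_mat_def mat1_def scalar_prod_def)

text \<open>The decomposition into symmetric and antisymmetric vectors at the level of determinants. After the tilde
  block has been eliminated, the plain and primed vertices carry a matrix of the form
  \<open>[[X, Y], [Y, X]]\<close>; here \<open>X + Y\<close> is the Schur complement that also occurs for \<open>LA n\<close>, and the
  correction terms of the elimination cancel in \<open>X - Y\<close>.\<close>

lemma char_poly_laplacian_pent:
  assumes n: "n \<ge> 2"
  shows "char_poly (laplacian (5 * n) (pent_vertex n) (pent_edges twist n)) =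
    char_poly (LA n) * char_poly (LS_corner (if twist then 1 else -1) n)"
    (is "char_poly ?L = _ * char_poly ?S")
proof (rule poly_eqI_off_point[of 2])
  fix x :: real assume x: "x \<noteq> 2"
  define c :: real where "c = (if twist then 1 else -1)"
  let ?P = "rim_block c n" and ?Q = "rung_block c n" and ?N = "N_twice n"
  let ?G = "transpose_mat (N_mat n) * N_mat n"
  let ?t = "1 / (x - 2)"
  let ?X = "x \<cdot>\<^sub>m 1\<^sub>m (2 * n) - ?P - ?t \<cdot>\<^sub>m ?G" and ?Y = "- 1 \<cdot>\<^sub>m ?Q - ?t \<cdot>\<^sub>m ?G"
  let ?D = "x \<cdot>\<^sub>m 1\<^sub>m (4 * n) - four_block_mat ?P ?Q ?Q ?P"
  have P: "?P \<in> carrier_mat (2 * n) (2 * n)" and Q: "?Q \<in> carrier_mat (2 * n) (2 * n)"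
    and S: "?S \<in> carrier_mat (2 * n) (2 * n)" and G: "?G \<in> carrier_mat (2 * n) (2 * n)"
    and N: "?N \<in> carrier_mat n (4 * n)"
    by (auto simp: rim_block_def rung_block_def LS_corner_def N_mat_def N_twice_def mat1_def)
  have D: "?D \<in> carrier_mat (4 * n) (4 * n)"
    using P by auto
  have L: "?L \<in> carrier_mat (5 * n) (5 * n)"
    by (simp add: laplacian_def grounded_laplacian_carrier)
  have "x \<cdot>\<^sub>m 1\<^sub>m (5 * n) - ?L =
      four_block_mat ((x - 2) \<cdot>\<^sub>m 1\<^sub>m n) (- 1 \<cdot>\<^sub>m ?N) (- 1 \<cdot>\<^sub>m transpose_mat ?N) ?D"
    unfolding laplacian_pent[OF n, of twist, folded c_def]
    using P N by (intro eq_matI) auto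
  then have "poly (char_poly ?L) x =
      (x - 2) ^ n * det (?D - ?t \<cdot>\<^sub>m ((- 1 \<cdot>\<^sub>m transpose_mat ?N) * (- 1 \<cdot>\<^sub>m ?N)))"
    using x N D det_four_block_schur[of "x - 2" "- 1 \<cdot>\<^sub>m ?N" n "4 * n" "- 1 \<cdot>\<^sub>m transpose_mat ?N" ?D]
    by (simp add: poly_char_poly_eq_det[OF L])
  also have "(- 1 \<cdot>\<^sub>m transpose_mat ?N) * (- 1 \<cdot>\<^sub>m ?N) = transpose_mat ?N * ?N"
    using N by (intro eq_matI) (auto simp: scalar_prod_def)
  also have "?D - ?t \<cdot>\<^sub>m (transpose_mat ?N * ?N) = four_block_mat ?X ?Y ?Y ?X"
    unfolding N_twice_gram
    using P Q G carrier_matD[OF N_mat_carrier[of n]] by (intro eq_matI) auto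
  also have "det \<dots> = det (?X + ?Y) * det (?X - ?Y)"
    using P Q G by (intro det_four_block_symmetric) auto
  also have "?X + ?Y = schur_core x n"
    unfolding schur_core_def rim_block_def rung_block_def
    using G by (intro eq_matI) (auto simp: C_mat_def LS_corner_def mat1_def field_simps)
  also have "?X - ?Y = x \<cdot>\<^sub>m 1\<^sub>m (2 * n) - ?S"
    unfolding rim_block_def rung_block_def c_def[symmetric]
    using G by (intro eq_matI) (auto simp: C_mat_def LS_corner_def mat1_def field_simps)
  finally show "poly (char_poly ?L) x = poly (char_poly (LA n) * char_poly ?S) x"
    by (simp add: poly_char_poly_LA[OF x] poly_char_poly_eq_det[OF S])
qed

section \<open>Counting the spanning trees\<close>

text \<open>The coefficient of \<open>x\<close> is compared in the factorization of the characteristic polynomial of the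
  Laplacian. As 0 is an eigenvalue of \<open>LA n\<close>, the second factor enters only through its constant
  term.\<close>

lemma num_spanning_trees_pent:
  fixes twist :: bool and c :: real
  assumes n: "n \<ge> 2"
  defines "c \<equiv> if twist then 1 else -1"
  shows "real (num_spanning_trees (pent_graph twist n)) =
    (-1) ^ (3 * n - 1) * coeff (char_poly (LA n)) 1 * det (LS_corner c n) / (5 * real n)"
    (is "real ?\<tau> = _ * ?a1 * det ?S / _")
proof -
  let ?L = "laplacian (5 * n) (pent_vertex n) (pent_edges twist n)"
  have S: "?S \<in> carrier_mat (2 * n) (2 * n)" by (simp add: LS_corner_def mat1_def)
  have "coeff (char_poly (LA n)) 0 = 0"
    using char_poly_LA_root_0[OF n] by (simp add: poly_0_coeff_0)
  then have "coeff (char_poly (LA n) * char_poly ?S) 1 = ?a1 * det ?S"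
    by (simp add: coeff_mult char_poly_coeff_0[OF S])
  then have "?a1 * det ?S = coeff (char_poly ?L) 1"
    by (simp only: char_poly_laplacian_pent[OF n] c_def)
  also have "\<dots> = (-1) ^ (5 * n - 1) * real (5 * n) * real ?\<tau>"
    using char_poly_laplacian_coeff_1[of "pent_vertices n" "pent_edges twist n" "pent_vertex n" "5 * n"]
      simple_graph_pent[of n twist] bij_betw_pent_vertex[of n] n
    by (simp add: pent_graph_def)
  also have "(-1 :: real) ^ (5 * n - 1) = (-1) ^ (3 * n - 1)"
    using n by (auto simp: minus_one_power_iff)
  finally have "(-1) ^ (3 * n - 1) * ?a1 * det ?S =
      ((-1) ^ (3 * n - 1) * (-1) ^ (3 * n - 1)) * (real (5 * n) * real ?\<tau>)"
    by (simp only: mult.assoc)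
  also have "(-1 :: real) ^ (3 * n - 1) * (-1) ^ (3 * n - 1) = 1"
    by (simp flip: power_mult_distrib)
  finally show ?thesis using n by (simp add: field_simps)
qed

lemma vieta_lucas_10:
  "vieta_lucas n 10 = (sqrt 2 + sqrt 3) ^ (2 * n) + (sqrt 2 - sqrt 3) ^ (2 * n)"
proof -
  have s: "(sqrt 2 + sqrt 3)\<^sup>2 = 5 + 2 * sqrt 6" "(sqrt 2 - sqrt 3)\<^sup>2 = 5 - 2 * sqrt 6"
    by (simp_all add: power2_eq_square algebra_simps flip: real_sqrt_mult)
  have "(5 + 2 * sqrt 6) * (5 - 2 * sqrt 6) = 1"
    by (simp add: algebra_simps)
  from vieta_lucas_power_sum[OF this, of n] show ?thesis
    by (simp add: power_mult s)
qed

lemma spanning_tree_formulas: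
  fixes twist :: bool and \<tau> c :: real
  assumes n: "n \<ge> 2"
  defines "\<tau> \<equiv> real (num_spanning_trees (pent_graph twist n))"
    and "c \<equiv> if twist then 1 else -1"
  shows "\<tau> = (\<Prod>i=2..3*n. eigval (LA n) i) * (\<Prod>j=1..2*n. eigval (LS_corner c n) j) / (5 * real n)"
    and "\<tau> = (-1) ^ (3*n - 1) * coeff (char_poly (LA n)) 1 * det (LS_corner c n) / (5 * real n)"
    and "\<tau> = 2 ^ n * real n * ((sqrt 2 + sqrt 3) ^ (2*n) + (sqrt 2 - sqrt 3) ^ (2*n) + 2 * c)"
proof -
  show \<tau>: "\<tau> = (-1) ^ (3*n - 1) * coeff (char_poly (LA n)) 1 * det (LS_corner c n) / (5 * real n)"
    unfolding \<tau>_def c_def by (rule num_spanning_trees_pent[OF n])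
  have S: "LS_corner c n \<in> carrier_mat (2 * n) (2 * n)" "transpose_mat (LS_corner c n) = LS_corner c n"
    by (auto simp: LS_corner_def mat1_def)
  show "\<tau> = (\<Prod>i=2..3*n. eigval (LA n) i) * (\<Prod>j=1..2*n. eigval (LS_corner c n) j) / (5 * real n)"
    using prod_eigval_from_2[OF LA_carrier LA_symmetric char_poly_LA_root_0[OF n]
        char_poly_LA_roots_nonneg[OF n]]
    by (simp only: \<tau> prod_eigval[OF S])
  have "det (LS_corner c n) = (sqrt 2 + sqrt 3) ^ (2*n) + (sqrt 2 - sqrt 3) ^ (2*n) + 2 * c"
    using det_LS_corner[OF n, of c] by (simp add: c_def vieta_lucas_10)
  moreover have "(-1) ^ (3 * n - 1) * coeff (char_poly (LA n)) 1 = 5 * (real n)\<^sup>2 * 2 ^ n"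
    unfolding char_poly_LA_coeff_1[OF n]
    by (simp flip: mult.assoc power_mult_distrib)
  ultimately show "\<tau> = 2 ^ n * real n * ((sqrt 2 + sqrt 3) ^ (2*n) + (sqrt 2 - sqrt 3) ^ (2*n) + 2 * c)"
    using n by (simp add: \<tau> power2_eq_square)
qed

theorem theorem2:
  fixes n :: nat
  assumes "n \<ge> 2"
  shows
    "(let \<tau> = real (num_spanning_trees (pent_cylinder n)) in
        \<tau> = (\<Prod>i=2..3*n. eigval (LA n) i) * (\<Prod>j=1..2*n. eigval (LS n) j) / (5 * real n)
      \<and> \<tau> = (-1) ^ (3*n - 1) * coeff (char_poly (LA n)) 1 * det (LS n) / (5 * real n)
      \<and> \<tau> = 2 ^ n * real n * ((sqrt 2 + sqrt 3) ^ (2*n) + (sqrt 2 - sqrt 3) ^ (2*n) - 2))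
   \<and> (let \<tau>' = real (num_spanning_trees (pent_moebius n)) in
        \<tau>' = (\<Prod>i=2..3*n. eigval (LA n) i) * (\<Prod>j=1..2*n. eigval (LS' n) j) / (5 * real n)
      \<and> \<tau>' = (-1) ^ (3*n - 1) * coeff (char_poly (LA n)) 1 * det (LS' n) / (5 * real n)
      \<and> \<tau>' = 2 ^ n * real n * ((sqrt 2 + sqrt 3) ^ (2*n) + (sqrt 2 - sqrt 3) ^ (2*n) + 2))"
  using spanning_tree_formulas[OF assms, of False] spanning_tree_formulas[OF assms, of True]
  unfolding Let_def pent_cylinder_eq pent_moebius_eq LS_def LS'_def by simp

end
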